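(* Let $m,n,r$ be positive integers, let $M\in\mathbb{R}^{m\times n}$, let $f_{\mathrm a}:\mathbb{R}^{m\times r}\times\mathbb{R}^{r\times n}\to\mathbb{R}$ be defined by $f_{\mathrm a}(X,Y):=\|XY-M\|_F^2$, and let $\mathcal{A}\times\mathcal{B}$ be an open bounded subset of $\mathbb{R}^{n\times r}\times\mathbb{R}^{r\times n}$. There exists $\overline{\alpha}>0$ such that for all $\alpha\in(0,\overline{\alpha}]$, gradient descent with step size $\alpha$ applied to $f_{\mathrm a}$ and initialized at $(X_0,Y_0)=(MA,B)$ converges linearly to a global minimum of $f_{\mathrm a}$ for almost every $(A,B)\in\mathcal{A}\times\mathcal{B}$.
   Context: Gradient descent with step size $\alpha$ is the iteration $(X_{k+1},Y_{k+1})=(X_k,Y_k)-\alpha\nabla f_{\mathrm a}(X_k,Y_k)$, $k\in\mathbb{N}$. Linear convergence of the iterates to $(X^*,Y^* )$ means that there exist $C>0$ and $q\in(0,1)$ (depending on the sequence) with $\|(X_k,Y_k)-(X^*,Y^* )\|_F\le Cq^k$ for all $k$. "Almost every" is with respect to Lebesgue measure. $\|\cdot\|_F$ is the Frobenius norm. *)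

theory Defs
  imports "HOL-Analysis.Analysis"
begin

(* On real ^ 'b ^ 'a the library norm is the Frobenius norm. *)
lemma norm_matrix_frobenius:
  fixes A :: "real ^ 'b ^ 'a"
  shows "norm A = sqrt (\<Sum>i\<in>UNIV. \<Sum>j\<in>UNIV. (A $ i $ j)\<^sup>2)"
  by (simp add: norm_vec_def L2_set_def sum_nonneg)

(* On pairs of matrices the library norm is the Frobenius norm of the pair. *)
lemma norm_matrix_pair_frobenius:
  fixes X :: "real ^ 'b ^ 'a" and Y :: "real ^ 'd ^ 'c"
  shows "norm (X, Y) =
    sqrt ((\<Sum>i\<in>UNIV. \<Sum>j\<in>UNIV. (X $ i $ j)\<^sup>2) + (\<Sum>i\<in>UNIV. \<Sum>j\<in>UNIV. (Y $ i $ j)\<^sup>2))"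
  by (simp add: norm_Pair norm_matrix_frobenius sum_nonneg)

definition fact_loss ::
  "real ^ 'n ^ 'm \<Rightarrow> (real ^ 'r ^ 'm) \<times> (real ^ 'n ^ 'r) \<Rightarrow> real" where
  "fact_loss M = (\<lambda>(X, Y). (norm (X ** Y - M))\<^sup>2)"

definition gradient :: "('a::real_inner \<Rightarrow> real) \<Rightarrow> 'a \<Rightarrow> 'a" where
  "gradient f x = (THE D. GDERIV f x :> D)"

lemma gradient_eqI:
  assumes "GDERIV f x :> D"
  shows "gradient f x = D"
  unfolding gradient_def
proof (rule the_equality)
  fix D' assume "GDERIV f x :> D'"
  with assms have "(\<lambda>h. inner h D') = (\<lambda>h. inner h D)"
    unfolding gderiv_def by (rule has_derivative_unique[rotated])
  then have "inner (D' - D) D' = inner (D' - D) D" by metis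
  then have "inner (D' - D) (D' - D) = 0" by (simp add: inner_diff_right)
  then show "D' = D" by simp
qed (rule assms)

primrec gradient_descent ::
  "('a::real_inner \<Rightarrow> real) \<Rightarrow> real \<Rightarrow> 'a \<Rightarrow> nat \<Rightarrow> 'a" where
  "gradient_descent f \<alpha> z0 0 = z0"
| "gradient_descent f \<alpha> z0 (Suc k) =
     gradient_descent f \<alpha> z0 k - \<alpha> *\<^sub>R gradient f (gradient_descent f \<alpha> z0 k)"

definition converges_linearly_to :: "(nat \<Rightarrow> 'a::real_normed_vector) \<Rightarrow> 'a \<Rightarrow> bool" where
  "converges_linearly_to z l \<longleftrightarrow>
     (\<exists>C>0. \<exists>q\<in>{0<..<1}. \<forall>k. norm (z k - l) \<le> C * q ^ k)"

definition is_global_min :: "('a \<Rightarrow> real) \<Rightarrow> 'a \<Rightarrow> bool" where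
  "is_global_min f x \<longleftrightarrow> (\<forall>y. f x \<le> f y)"

end

theory Submission
  imports Defs
begin

text \<open>
  Write \<open>E = M - X Y\<close>. Up to the factor \<open>-2\<close> the gradient of the loss is \<open>(E Y\<^sup>T, X\<^sup>T E)\<close>. The
  initialization \<open>X\<^sub>0 = M A\<close> confines the columns of \<open>X\<close> to the range of \<open>M\<close> for ever, because
  \<open>E Y\<^sup>T = M (I - A Y) Y\<^sup>T\<close> has this property whenever \<open>X = M A\<close> has it. On that invariant set the
  loss behaves as if \<open>M\<close> had full row rank, and this is what makes the convergence linear. Four
  facts combine.

  First, the iterates stay bounded, with one step size bound for all starting points in a bounded
  set. The gradient flow preserves the imbalance \<open>X\<^sup>T X - Y Y\<^sup>T\<close>; a gradient step changes it only by
  \<open>\<alpha>\<^sup>2 \<parallel>\<nabla>f\<parallel>\<^sup>2\<close>, while it lowers the loss by at least \<open>\<alpha>/2 \<parallel>\<nabla>f\<parallel>\<^sup>2\<close>. Hence the total drift of the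
  imbalance is bounded by a multiple of the initial loss, and imbalance and loss together control
  the norm (\<open>gradient_descent_bounded_and_decreasing\<close>).

  Secondly, on every bounded part of the invariant set there is a finite set of levels such that the
  loss is always within \<open>K \<parallel>\<nabla>f\<parallel>\<^sup>2\<close> of one of them (\<open>loss_Lojasiewicz\<close>). With
  \<open>\<epsilon> = \<parallel>\<nabla>f\<parallel>\<close>, each eigenvalue of \<open>E\<^sup>T E\<close> lies within \<open>O(\<epsilon>\<^sup>2)\<close> of \<open>0\<close> or of an eigenvalue of
  \<open>M\<^sup>T M\<close>: if \<open>b\<close> is an eigenvector for a large eigenvalue, then \<open>b\<close> is an eigenvector of \<open>M\<^sup>T M\<close> up to
  a residual \<open>O(\<epsilon>)\<close>, and its Rayleigh quotient is right up to \<open>O(\<epsilon>\<^sup>2)\<close>, so that the quadratic error bound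
  for Rayleigh quotients applies; small eigenvalues are \<open>O(\<epsilon>\<^sup>2)\<close> because \<open>M\<^sup>T\<close> is bounded below on the
  range of \<open>M\<close>. The loss is the sum of these eigenvalues. Since it converges along the iteration, its
  level is eventually constant, and the inequality then makes the excess loss, and
  with it the step length, decay geometrically (\<open>descent_finite_levels_converges_linearly\<close>). Thus
  every orbit, generic or not, converges linearly to a critical point.

  Thirdly, a critical point \<open>(M A, Y)\<close> that is not a global minimum has a direction \<open>(M U, V)\<close> of
  negative curvature (\<open>second_order_critical_imp_global_min\<close>). If \<open>u, v\<close> is a top singular
  pair of \<open>E\<close> with singular value \<open>s\<close>, then the directions \<open>(u a\<^sup>T, b v\<^sup>T)\<close> show that nonnegative
  curvature forces \<open>X\<close> to be injective and all singular values of \<open>X Y\<close> to be at least \<open>s\<close>. So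
  \<open>M = X Y + E\<close> splits the singular values of \<open>M\<close> into the \<open>r\<close> largest ones and the others, and the
  Eckart-Young argument applies.

  Fourthly, almost no orbit converges to such a saddle (\<open>strict_saddles_avoided\<close>). No stable manifold
  is constructed. Near a saddle \<open>p\<close> there is a quadratic form that is positive in a direction of
  negative curvature and is expanded along the difference of any two orbits; hence two
  orbits that stay near \<open>p\<close> cannot differ initially by a multiple of that direction. The set of
  starting points whose orbits stay near \<open>p\<close> therefore has infinitely many disjoint translates inside
  a bounded set, so it is null. The Lindelof property reduces the possibly uncountable set of
  saddles to countably many neighbourhoods. Preimages of null sets under the iteration are null because the
  iteration is a small perturbation of the identity; to obtain this with respect to Lebesgue measure in the
  coordinates \<open>(A, B)\<close>, the iteration is lifted from \<open>(M A, B)\<close> to \<open>(A, B)\<close> through a generalized inverse of \<open>M\<close>.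
\<close>

section \<open>Frobenius geometry of matrices\<close>

lemma inner_matrix_columns:
  fixes A B :: "real ^ 'b ^ 'a"
  shows "inner A B = (\<Sum>j\<in>UNIV. inner (column j A) (column j B))"
  unfolding inner_vec_def column_def by (simp, rule sum.swap)

text \<open>Multiplication by a matrix has multiplication by its transpose as adjoint for the Frobenius
  inner product; this turns traces such as \<open>\<langle>X\<^sup>T X, Y Y\<^sup>T\<rangle>\<close> into norms.\<close>

lemma inner_matrix_mult_right_factor:
  fixes A :: "real ^ 'b ^ 'a" and B :: "real ^ 'c ^ 'b" and C :: "real ^ 'c ^ 'a"
  shows "inner (A ** B) C = inner B (transpose A ** C)"
proof -
  have "inner (A ** B) C = (\<Sum>j\<in>UNIV. inner (column j (A ** B)) (column j C))"
    by (rule inner_matrix_columns)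
  also have "\<dots> = (\<Sum>j\<in>UNIV. inner (column j B) (column j (transpose A ** C)))"
  proof (rule sum.cong)
    fix j
    have c: "column j (P ** Q) = P *v column j Q"
      for P :: "real ^ 'y ^ 'x" and Q :: "real ^ 'z ^ 'y" and j
      by (simp add: vec_eq_iff column_def matrix_matrix_mult_def matrix_vector_mult_def)
    show "inner (column j (A ** B)) (column j C) = inner (column j B) (column j (transpose A ** C))"
      unfolding c by (metis adjoint_matrix adjoint_works matrix_vector_mul_linear)
  qed simp
  also have "\<dots> = inner B (transpose A ** C)"
    by (rule inner_matrix_columns[symmetric])
  finally show ?thesis .
qed

lemma inner_transpose:
  fixes A B :: "real ^ 'b ^ 'a"
  shows "inner (transpose A) (transpose B) = inner A B"
  unfolding inner_vec_def transpose_def by (simp, rule sum.swap)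

lemma norm_transpose [simp]:
  fixes A :: "real ^ 'b ^ 'a"
  shows "norm (transpose A) = norm A"
  by (simp add: norm_eq_sqrt_inner inner_transpose)

lemma inner_matrix_mult_left_factor:
  fixes A :: "real ^ 'b ^ 'a" and B :: "real ^ 'c ^ 'b" and C :: "real ^ 'c ^ 'a"
  shows "inner (A ** B) C = inner A (C ** transpose B)"
proof -
  have "inner (A ** B) C = inner (transpose B ** transpose A) (transpose C)"
    by (simp add: inner_transpose flip: matrix_transpose_mul)
  also have "\<dots> = inner (transpose A) (transpose (C ** transpose B))"
    by (simp add: inner_matrix_mult_right_factor matrix_transpose_mul)
  finally show ?thesis by (simp only: inner_transpose)
qed

lemma norm_vec_square:
  fixes x :: "'a::real_inner ^ 'b"
  shows "(norm x)\<^sup>2 = (\<Sum>i\<in>UNIV. (norm (x $ i))\<^sup>2)"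
  by (simp add: power2_norm_eq_inner inner_vec_def)

lemma norm_matrix_vector_square:
  fixes A :: "real ^ 'b ^ 'a"
  shows "(norm (A *v x))\<^sup>2 = (\<Sum>i\<in>UNIV. (inner (A $ i) x)\<^sup>2)"
  unfolding norm_vec_square matrix_mult_dot by simp

lemma norm_matrix_vector_mult_le:
  fixes A :: "real ^ 'b ^ 'a"
  shows "norm (A *v x) \<le> norm A * norm x"
proof -
  have "(norm (A *v x))\<^sup>2 = (\<Sum>i\<in>UNIV. (inner (A $ i) x)\<^sup>2)"
    by (rule norm_matrix_vector_square)
  also have "\<dots> \<le> (\<Sum>i\<in>UNIV. (norm (A $ i))\<^sup>2 * (norm x)\<^sup>2)"
    by (intro sum_mono) (metis Cauchy_Schwarz_ineq power2_norm_eq_inner)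
  also have "\<dots> = (norm A)\<^sup>2 * (norm x)\<^sup>2"
    by (simp add: norm_vec_square[of A] sum_distrib_right)
  finally show ?thesis
    by (metis norm_ge_zero mult_nonneg_nonneg power2_le_imp_le power_mult_distrib)
qed

lemma norm_matrix_mult_le:
  fixes A :: "real ^ 'b ^ 'a" and B :: "real ^ 'c ^ 'b"
  shows "norm (A ** B) \<le> norm A * norm B"
proof -
  have row: "(A ** B) $ i = transpose B *v (A $ i)" for i
    by (simp add: vec_eq_iff matrix_matrix_mult_def matrix_vector_mult_def transpose_def mult.commute del: transpose_matrix_vector)
  have "(norm (A ** B))\<^sup>2 = (\<Sum>i\<in>UNIV. (norm ((A ** B) $ i))\<^sup>2)"
    by (rule norm_vec_square)
  also have "\<dots> \<le> (\<Sum>i\<in>UNIV. (norm B * norm (A $ i))\<^sup>2)"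
    unfolding row
    by (intro sum_mono power_mono) (use norm_matrix_vector_mult_le[of "transpose B"] in auto)
  also have "\<dots> = (norm A)\<^sup>2 * (norm B)\<^sup>2"
    by (simp add: norm_vec_square[of A] sum_distrib_left power_mult_distrib mult.commute)
  finally show ?thesis
    by (metis norm_ge_zero mult_nonneg_nonneg power2_le_imp_le power_mult_distrib)
qed

lemma matrix_add_rdistrib:
  fixes A B :: "real ^ 'b ^ 'a" and C :: "real ^ 'c ^ 'b"
  shows "(A + B) ** C = A ** C + B ** C"
  by (simp add: vec_eq_iff matrix_matrix_mult_def sum.distrib distrib_right)

lemma bounded_bilinear_matrix_mult:
  "bounded_bilinear ((**) :: real ^ 'b ^ 'a \<Rightarrow> real ^ 'c ^ 'b \<Rightarrow> real ^ 'c ^ 'a)"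
proof
  show "\<exists>K. \<forall>(a :: real ^ 'b ^ 'a) (b :: real ^ 'c ^ 'b). norm (a ** b) \<le> norm a * norm b * K"
    by (rule exI[of _ 1]) (simp add: norm_matrix_mult_le)
qed (simp_all add: matrix_add_rdistrib matrix_add_ldistrib,
    simp_all add: vec_eq_iff matrix_matrix_mult_def sum_distrib_left mult.assoc mult.left_commute)

interpretation matrix_mult: bounded_bilinear "(**) :: real ^ 'b ^ 'a \<Rightarrow> real ^ 'c ^ 'b \<Rightarrow> real ^ 'c ^ 'a"
  by (rule bounded_bilinear_matrix_mult)

lemma bounded_linear_transpose: "bounded_linear (transpose :: real ^ 'b ^ 'a \<Rightarrow> real ^ 'a ^ 'b)"
  by (rule bounded_linear_intro[of _ 1]) (simp_all add: vec_eq_iff, simp_all add: transpose_def)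

lemmas transpose_add = linear_add[OF bounded_linear.linear[OF bounded_linear_transpose]]
  and transpose_diff = linear_diff[OF bounded_linear.linear[OF bounded_linear_transpose]]

lemma transpose_0 [simp]: "transpose (0 :: real ^ 'b ^ 'a) = 0"
  by (simp add: vec_eq_iff transpose_def)

text \<open>The rank-one matrix \<open>p q\<^sup>T\<close>.\<close>

definition outer :: "real ^ 'a \<Rightarrow> real ^ 'b \<Rightarrow> real ^ 'b ^ 'a" where
  "outer p q = (\<chi> i j. p $ i * q $ j)"

lemma matrix_mult_outer: "A ** outer p q = outer (A *v p) q"
  by (simp add: vec_eq_iff outer_def matrix_matrix_mult_def matrix_vector_mult_def sum_distrib_right mult.assoc)

lemma outer_matrix_mult: "outer p q ** A = outer p (transpose A *v q)"
  by (simp add: vec_eq_iff outer_def matrix_matrix_mult_def matrix_vector_mult_def transpose_def sum_distrib_left algebra_simps del: transpose_matrix_vector)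

lemma inner_outer:
  fixes A :: "real ^ 'b ^ 'a"
  shows "inner A (outer p q) = inner p (A *v q)"
  by (simp add: inner_vec_def outer_def matrix_vector_mult_def sum_distrib_left algebra_simps)

lemma outer_mult_vector: "outer p q *v x = inner q x *\<^sub>R p"
  by (simp add: vec_eq_iff outer_def matrix_vector_mult_def inner_vec_def sum_distrib_left sum_distrib_right algebra_simps)

text \<open>The adjoint identity in terms of the transposed matrix. The simplification rule
  \<open>transpose_matrix_vector\<close>, which turns \<open>transpose A *v x\<close> into \<open>x v* A\<close>, would destroy this form, so
  the proofs that rely on adjoints switch it off.\<close>

lemma inner_transpose_mult_vector:
  fixes A :: "real ^ 'b ^ 'a"
  shows "inner (transpose A *v x) y = inner x (A *v y)"
  by (simp add: dot_lmul_matrix)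

section \<open>Orthonormal families and self-adjoint operators\<close>

lemma orthonormal_expansion:
  fixes B :: "'a::euclidean_space set"
  assumes "pairwise orthogonal B" "\<And>b. b \<in> B \<Longrightarrow> norm b = 1" "x \<in> span B"
  shows "x = (\<Sum>b\<in>B. inner x b *\<^sub>R b)"
proof -
  have ind: "independent B" using assms by (metis norm_zero pairwise_orthogonal_independent zero_neq_one)
  then have fin: "finite B" by (rule independent_imp_finite)
  obtain c where c: "x = (\<Sum>b\<in>B. c b *\<^sub>R b)"
    using assms(3) span_finite[OF fin] by auto
  have "inner x b = c b" if "b \<in> B" for b
  proof -
    have "inner x b = (\<Sum>a\<in>B. c a * inner a b)" by (simp add: c inner_sum_left)
    also have "\<dots> = (\<Sum>a\<in>B. if a = b then c b else 0)"
      using assms(1,2) that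
      by (intro sum.cong) (auto simp: pairwise_def orthogonal_def dot_square_norm)
    finally show ?thesis using fin that by simp
  qed
  with c show ?thesis by simp
qed

lemma orthonormal_Parseval:
  fixes B :: "'a::euclidean_space set"
  assumes "pairwise orthogonal B" "\<And>b. b \<in> B \<Longrightarrow> norm b = 1" "x \<in> span B"
  shows "inner x y = (\<Sum>b\<in>B. inner x b * inner y b)"
proof -
  have "inner x y = inner (\<Sum>b\<in>B. inner x b *\<^sub>R b) y"
    using orthonormal_expansion[OF assms] by simp
  also have "\<dots> = (\<Sum>b\<in>B. inner x b * inner y b)"
    by (simp add: inner_sum_left inner_commute[of y])
  finally show ?thesis .
qed

text \<open>Gram-Schmidt, followed by a normalization that leaves the given unit vectors as they are.\<close>

lemma orthonormal_extends_to_basis: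
  fixes B :: "'a::euclidean_space set"
  assumes "pairwise orthogonal B" "\<And>b. b \<in> B \<Longrightarrow> norm b = 1"
  shows "\<exists>B'. B \<subseteq> B' \<and> pairwise orthogonal B' \<and> (\<forall>b\<in>B'. norm b = 1) \<and> span B' = UNIV \<and> finite B'"
proof -
  obtain U where U: "U \<inter> insert 0 B = {}" "pairwise orthogonal (B \<union> U)" "span (B \<union> U) = span (B \<union> UNIV)"
    using orthogonal_extension_strong[OF assms(1), of UNIV] by blast
  let ?n = "\<lambda>x. x /\<^sub>R norm x"
  let ?B = "?n ` (B \<union> U)"
  have n0: "x \<noteq> 0" if "x \<in> B \<union> U" for x using U(1) assms(2) that by force
  have nB: "?n x = x" if "x \<in> B" for x using assms(2) that by simp
  have 1: "B \<subseteq> ?B" using image_mono[of B "B \<union> U" ?n] nB by (simp add: image_cong[of B B ?n "\<lambda>x. x"])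
  have 2: "pairwise orthogonal ?B"
  proof (rule pairwiseI)
    fix x y assume xy: "x \<in> ?B" "y \<in> ?B" "x \<noteq> y"
    then obtain a b where ab: "x = ?n a" "y = ?n b" "a \<in> B \<union> U" "b \<in> B \<union> U" by blast
    then have "a \<noteq> b" using xy(3) by auto
    then have "orthogonal a b" using U(2) ab by (simp add: pairwise_def)
    then show "orthogonal x y" unfolding ab by (simp add: orthogonal_def)
  qed
  have 3: "\<forall>b\<in>?B. norm b = 1" using n0 by auto
  have 4: "span ?B = UNIV"
  proof -
    have "B \<union> U \<subseteq> span ?B"
    proof
      fix x assume x: "x \<in> B \<union> U"
      then have "norm x *\<^sub>R ?n x \<in> span ?B" by (intro span_scale span_base) auto
      then show "x \<in> span ?B" using n0[OF x] by simp
    qed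
    then have "span (B \<union> U) \<subseteq> span ?B" by (simp add: span_minimal)
    moreover have "span (B \<union> UNIV) = UNIV" by simp
    ultimately show ?thesis using U(3) by auto
  qed
  have 5: "finite ?B" using 2 3 
    by (metis independent_imp_finite norm_zero pairwise_orthogonal_independent zero_neq_one)
  show ?thesis using 1 2 3 4 5 by blast
qed

text \<open>The trace of \<open>A\<^sup>T A\<close> does not depend on the orthonormal basis in which it is evaluated.\<close>

lemma norm_matrix_orthonormal:
  fixes A :: "real ^ 'b ^ 'a" and B :: "(real ^ 'b) set"
  assumes "pairwise orthogonal B" "\<And>b. b \<in> B \<Longrightarrow> norm b = 1" "span B = UNIV"
  shows "(norm A)\<^sup>2 = (\<Sum>b\<in>B. (norm (A *v b))\<^sup>2)"
proof -
  have "(norm A)\<^sup>2 = (\<Sum>i\<in>UNIV. inner (A $ i) (A $ i))"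
    by (simp add: power2_norm_eq_inner inner_vec_def[of A])
  also have "\<dots> = (\<Sum>i\<in>UNIV. \<Sum>b\<in>B. inner (A $ i) b * inner (A $ i) b)"
    by (intro sum.cong refl orthonormal_Parseval assms(1,2)) (simp_all add: assms(3))
  also have "\<dots> = (\<Sum>b\<in>B. \<Sum>i\<in>UNIV. inner (A $ i) b * inner (A $ i) b)"
    by (rule sum.swap)
  also have "\<dots> = (\<Sum>b\<in>B. (norm (A *v b))\<^sup>2)"
    by (intro sum.cong refl) (simp add: norm_matrix_vector_square flip: power2_eq_square)
  finally show ?thesis .
qed

lemma norm_diff_scaleR_square:
  fixes a b :: "'a::real_inner"
  shows "(norm (a - k *\<^sub>R b))\<^sup>2 = (norm a)\<^sup>2 - 2 * k * inner a b + k\<^sup>2 * (norm b)\<^sup>2"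
proof -
  have "inner b a = inner a b" by (rule inner_commute)
  then show ?thesis
    unfolding power2_norm_eq_inner
    by (simp add: inner_diff_left inner_diff_right algebra_simps) (simp add: power2_eq_square)
qed

text \<open>A maximizer \<open>v\<close> of the Rayleigh quotient on the unit sphere of the subspace is an eigenvector, by
  the first-order condition in the direction \<open>T v - l v\<close>.\<close>

lemma selfadjoint_eigenvector_in_invariant_subspace:
  fixes T :: "'a::euclidean_space \<Rightarrow> 'a"
  assumes lin: "linear T" and sa: "\<And>x y. inner (T x) y = inner x (T y)"
    and S: "subspace S" "\<And>x. x \<in> S \<Longrightarrow> T x \<in> S" and ne: "S \<noteq> {0}"
  shows "\<exists>v\<in>S. norm v = 1 \<and> (\<exists>l. T v = l *\<^sub>R v)"
proof -
  let ?K = "S \<inter> sphere 0 1"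
  have comp: "compact ?K"
    by (simp add: closed_Int_compact closed_subspace S(1))
  obtain x where x: "x \<in> S" "x \<noteq> 0" using ne S(1) subspace_0 by blast
  then have "x /\<^sub>R norm x \<in> ?K" using S(1) by (simp add: subspace_scale)
  then have neK: "?K \<noteq> {}" by blast
  have cont: "continuous_on ?K (\<lambda>v. inner v (T v))"
    by (intro continuous_intros linear_continuous_on linear_linear[THEN iffD2] lin)
  obtain v where v: "v \<in> ?K" and max: "\<And>w. w \<in> ?K \<Longrightarrow> inner w (T w) \<le> inner v (T v)"
    using continuous_attains_sup[OF comp neK cont] by blast
  define l where "l = inner v (T v)"
  have vS: "v \<in> S" and nv: "norm v = 1" using v by auto
  have vv: "inner v v = 1" using nv by (simp add: dot_square_norm)
  have bound: "inner w (T w) \<le> l * (norm w)\<^sup>2" if "w \<in> S" for w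
  proof (cases "w = 0")
    case True then show ?thesis by (simp add: linear_0[OF lin])
  next
    case False
    then have "w /\<^sub>R norm w \<in> ?K" using that S(1) by (simp add: subspace_scale)
    from max[OF this] have "inner w (T w) / (norm w)\<^sup>2 \<le> l"
      by (simp add: linear_scale[OF lin] l_def power2_eq_square field_simps)
    then show ?thesis using False by (simp add: field_simps)
  qed
  define w where "w = T v - l *\<^sub>R v"
  have wS: "w \<in> S" unfolding w_def by (intro subspace_diff subspace_scale S vS)
  have vw: "inner v w = 0"
    using nv by (simp add: w_def inner_diff_right l_def dot_square_norm)
  have Tvw: "inner w (T v) = (norm w)\<^sup>2"
    using vw by (simp add: power2_norm_eq_inner w_def inner_diff_right inner_diff_left algebra_simps inner_commute)
  \<comment> \<open>the Rayleigh quotient cannot increase along the line \<open>v + t w\<close>, which forces \<open>w = 0\<close>\<close>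
  have "2 * t * (norm w)\<^sup>2 \<le> t\<^sup>2 * (l * (norm w)\<^sup>2 - inner w (T w))" for t
  proof -
    have "inner (v + t *\<^sub>R w) (T (v + t *\<^sub>R w)) \<le> l * (norm (v + t *\<^sub>R w))\<^sup>2"
      by (intro bound subspace_add subspace_scale S vS wS)
    moreover have "inner (v + t *\<^sub>R w) (T (v + t *\<^sub>R w)) = l + 2 * t * (norm w)\<^sup>2 + t\<^sup>2 * inner w (T w)"
    proof -
      have "inner v (T w) = (norm w)\<^sup>2" using Tvw sa by (metis inner_commute)
      then show ?thesis
        by (simp add: linear_add[OF lin] linear_scale[OF lin] inner_add_left inner_add_right Tvw
            flip: l_def) (simp add: power2_eq_square algebra_simps)
    qed
    moreover have "(norm (v + t *\<^sub>R w))\<^sup>2 = 1 + t\<^sup>2 * (norm w)\<^sup>2"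
      using vw vv by (simp add: power2_norm_eq_inner inner_add_left inner_add_right inner_commute[of w v])
         (simp add: power2_eq_square)
    ultimately show ?thesis by (simp add: algebra_simps)
  qed
  note ineq = this
  have "w = 0"
  proof (rule ccontr)
    assume "w \<noteq> 0"
    define c where "c = l * (norm w)\<^sup>2 - inner w (T w)"
    \<comment> \<open>small enough for the term quadratic in \<open>t\<close> to be dominated by the linear one\<close>
    define t where "t = (norm w)\<^sup>2 / (\<bar>c\<bar> + 1)"
    have t: "t > 0" using \<open>w \<noteq> 0\<close> by (simp add: t_def)
    have "2 * (norm w)\<^sup>2 * t \<le> (t * c) * t" using ineq[of t] by (simp add: c_def power2_eq_square algebra_simps)
    then have "2 * (norm w)\<^sup>2 \<le> t * c" using t by (simp add: mult.commute)
    also have "\<dots> \<le> t * (\<bar>c\<bar> + 1)" using t by (intro mult_left_mono) auto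
    also have "\<dots> = (norm w)\<^sup>2" by (simp add: t_def)
    finally show False using \<open>w \<noteq> 0\<close> by simp
  qed
  then show ?thesis using vS nv by (auto simp: w_def)
qed

text \<open>The real spectral theorem, by splitting off one eigenvector at a time: the orthogonal complement of
  an eigenvector in an invariant subspace is again invariant.\<close>

theorem selfadjoint_orthonormal_eigenbasis:
  fixes T :: "'a::euclidean_space \<Rightarrow> 'a"
  assumes lin: "linear T" and sa: "\<And>x y. inner (T x) y = inner x (T y)"
  shows "\<exists>B l. pairwise orthogonal B \<and> (\<forall>b\<in>B. norm b = 1 \<and> T b = l b *\<^sub>R b) \<and> span B = UNIV \<and> finite B"
proof -
  have *: "\<exists>B. B \<subseteq> S \<and> pairwise orthogonal B \<and> (\<forall>b\<in>B. norm b = 1 \<and> (\<exists>l. T b = l *\<^sub>R b)) \<and> span B = S"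
    if "subspace S" "\<And>x. x \<in> S \<Longrightarrow> T x \<in> S" for S
    using that
  proof (induction "dim S" arbitrary: S rule: less_induct)
    case less
    show ?case
    proof (cases "S = {0}")
      case True then show ?thesis by (intro exI[of _ "{}"]) auto
    next
      case False
      obtain v l where v: "v \<in> S" "norm v = 1" "T v = l *\<^sub>R v"
        using selfadjoint_eigenvector_in_invariant_subspace[OF lin sa less.prems False] by blast
      define S' where "S' = S \<inter> {x. inner v x = 0}"
      have sub': "subspace S'" unfolding S'_def
        by (intro subspace_inter less.prems subspace_hyperplane)
      have inv': "T x \<in> S'" if "x \<in> S'" for x
      proof -
        have "inner v (T x) = inner (T v) x" by (simp add: sa)
        also have "\<dots> = 0" using that by (simp add: v S'_def)
        finally show ?thesis using that less.prems by (simp add: S'_def)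
      qed
      have "v \<notin> S'" using v(2) by (auto simp: S'_def)
      then have "S' \<subset> S" using v(1) unfolding S'_def by blast
      then have "dim S' < dim S"
        using sub' less.prems(1) by (metis dim_psubset span_eq_iff)
      then obtain B where B: "B \<subseteq> S'" "pairwise orthogonal B"
        "\<forall>b\<in>B. norm b = 1 \<and> (\<exists>l. T b = l *\<^sub>R b)" "span B = S'"
        using less.hyps[OF _ sub' inv'] by blast
      have "span (insert v B) = S"
      proof
        show "span (insert v B) \<subseteq> S"
          using B(1) v(1) less.prems(1) by (intro span_minimal) (auto simp: S'_def)
        show "S \<subseteq> span (insert v B)"
        proof
          fix x assume x: "x \<in> S"
          have "x - inner v x *\<^sub>R v \<in> S'" unfolding S'_def
            using x v less.prems(1)
            by (simp add: subspace_diff subspace_scale inner_diff_right dot_square_norm)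
          then show "x \<in> span (insert v B)" using B(4) by (auto simp: span_insert)
        qed
      qed
      moreover have "pairwise orthogonal (insert v B)"
        using B(1,2) by (auto simp: pairwise_insert orthogonal_def S'_def inner_commute)
      moreover have "insert v B \<subseteq> S" using v(1) B(1) by (auto simp: S'_def)
      ultimately show ?thesis using B(3) v by (intro exI[of _ "insert v B"]) auto
    qed
  qed
  obtain B where B: "pairwise orthogonal B" "\<forall>b\<in>B. norm b = 1 \<and> (\<exists>l. T b = l *\<^sub>R b)" "span B = UNIV"
    using *[of UNIV] by auto
  then have "finite B"
    by (metis independent_imp_finite norm_zero pairwise_orthogonal_independent zero_neq_one)
  moreover obtain l where "\<forall>b\<in>B. T b = l b *\<^sub>R b" using B(2) by metis
  ultimately show ?thesis using B by blast
qed

text \<open>The error of an approximate eigenvalue \<open>\<rho>\<close> is quadratic in the residual \<open>\<epsilon>\<close> once the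
  Rayleigh quotient is known to agree with \<open>\<rho>\<close> up to \<open>\<delta>\<close>. If \<open>x \<le> \<rho> < y\<close> with consecutive eigenvalues
  \<open>x\<close> and \<open>y\<close>, then \<open>(T - x)(T - y)\<close> is positive semidefinite, and evaluating it at \<open>w\<close> bounds
  \<open>(\<rho> - x)(y - \<rho>)\<close> by \<open>\<epsilon>\<^sup>2\<close> plus a multiple of \<open>\<delta>\<close>; one of the two factors is at least half the
  smallest spectral gap. Outside the spectrum, the extremal eigenvalues bound the Rayleigh quotient.
  The constants depend on \<open>T\<close> only, which gives uniformity along a whole orbit.\<close>

lemma Rayleigh_quotient_near_eigenvalue:
  fixes T :: "'a::euclidean_space \<Rightarrow> 'a"
  assumes lin: "linear T" and sa: "\<And>x y. inner (T x) y = inner x (T y)"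
  shows "\<exists>\<Lambda> K. finite \<Lambda> \<and> K > 0 \<and> (\<forall>w \<rho> \<epsilon> \<delta>. norm w = 1 \<longrightarrow> norm (T w - \<rho> *\<^sub>R w) \<le> \<epsilon> \<longrightarrow>
     \<bar>inner w (T w) - \<rho>\<bar> \<le> \<delta> \<longrightarrow> (\<exists>l\<in>\<Lambda>. \<bar>\<rho> - l\<bar> \<le> K * (\<epsilon>\<^sup>2 + \<delta>)))"
proof -
  obtain B l where B: "pairwise orthogonal B" "\<And>b. b \<in> B \<Longrightarrow> norm b = 1" "span B = UNIV" "finite B"
    and eig: "\<And>b. b \<in> B \<Longrightarrow> T b = l b *\<^sub>R b"
    using selfadjoint_orthonormal_eigenbasis[OF lin sa] by blast
  define \<Lambda> where "\<Lambda> = l ` B"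
  have fin: "finite \<Lambda>" using B(4) by (simp add: \<Lambda>_def)
  have "B \<noteq> {}"
  proof
    assume "B = {}"
    then have "(SOME b. b \<in> Basis) \<in> {0::'a}" using B(3) by auto
    then show False using nonzero_Basis[of "SOME b. b \<in> (Basis :: 'a set)"] someI_ex[of "\<lambda>b. b \<in> (Basis :: 'a set)"] nonempty_Basis
      by (metis all_not_in_conv singletonD)
  qed
  then have ne: "\<Lambda> \<noteq> {}" by (simp add: \<Lambda>_def)
  \<comment> \<open>the smallest spectral gap; inserting \<open>1\<close> covers the case of a single eigenvalue\<close>
  define g where "g = Min (insert 1 {y - x | x y. x \<in> \<Lambda> \<and> y \<in> \<Lambda> \<and> x < y})"
  have fing: "finite {y - x | x y. x \<in> \<Lambda> \<and> y \<in> \<Lambda> \<and> x < y}"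
    by (rule finite_subset[of _ "(\<lambda>(x,y). y - x) ` (\<Lambda> \<times> \<Lambda>)"]) (use fin in auto)
  have gpos: "g > 0" unfolding g_def using fing by (subst Min_gr_iff) auto
  have gle: "g \<le> y - x" if "x \<in> \<Lambda>" "y \<in> \<Lambda>" "x < y" for x y
    unfolding g_def by (rule Min_le) (use fing that in auto)
  define D where "D = Max \<Lambda> - Min \<Lambda>"
  have D: "y - x \<le> D" if "x \<in> \<Lambda>" "y \<in> \<Lambda>" for x y
    unfolding D_def using fin that Max_ge[OF fin] Min_le[OF fin] by (meson diff_mono)
  have D0: "0 \<le> D" using ne D by (metis all_not_in_conv diff_self)
  define K where "K = 1 + 2 * (1 + D) / g"
  have K0: "K > 0" unfolding K_def using D0 gpos by (simp add: add_pos_nonneg)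
  have K1: "K \<ge> 1" unfolding K_def using D0 gpos by simp
  have main: "\<exists>l\<in>\<Lambda>. \<bar>\<rho> - l\<bar> \<le> K * (\<epsilon>\<^sup>2 + \<delta>)"
    if w: "norm w = 1" and e: "norm (T w - \<rho> *\<^sub>R w) \<le> \<epsilon>" and d: "\<bar>inner w (T w) - \<rho>\<bar> \<le> \<delta>" for w \<rho> \<epsilon> \<delta>
  proof -
    have ww: "inner w w = 1" using w by (simp add: dot_square_norm)
    have nrm: "(norm (T w - \<rho> *\<^sub>R w))\<^sup>2 = inner (T w) (T w) - 2 * \<rho> * inner w (T w) + \<rho>\<^sup>2"
      using w inner_commute[of "T w" w] by (simp add: norm_diff_scaleR_square dot_square_norm)
    have coef: "inner (T w) b = l b * inner w b" if "b \<in> B" for b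
      using that eig by (simp add: sa)
    have pars: "inner x y = (\<Sum>b\<in>B. inner x b * inner y b)" for x y
      by (rule orthonormal_Parseval[OF B(1,2)]) (simp_all add: B(3))
    have one: "(\<Sum>b\<in>B. (inner w b)\<^sup>2) = 1"
      using pars[of w w] w by (simp add: dot_square_norm power2_eq_square)
    have wTw: "inner w (T w) = (\<Sum>b\<in>B. l b * (inner w b)\<^sup>2)"
      unfolding pars[of w "T w"] by (intro sum.cong) (simp_all add: coef power2_eq_square)
    have TwTw: "inner (T w) (T w) = (\<Sum>b\<in>B. (l b)\<^sup>2 * (inner w b)\<^sup>2)"
      unfolding pars[of "T w" "T w"] by (intro sum.cong) (simp_all add: coef power2_eq_square)
    have d0: "\<delta> \<ge> 0" using d by linarith
    have KS: "\<epsilon>\<^sup>2 + \<delta> \<le> K * (\<epsilon>\<^sup>2 + \<delta>)" using K1 d0 by (intro mult_right_mono[of 1 K, simplified]) auto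
    let ?L = "{x\<in>\<Lambda>. x \<le> \<rho>}" and ?U = "{x\<in>\<Lambda>. \<rho> < x}"
    consider "?U = {}" | "?L = {}" | "?U \<noteq> {}" "?L \<noteq> {}" by blast
    then show ?thesis
    proof cases
      case 1
      let ?m = "Max \<Lambda>"
      have m: "?m \<in> \<Lambda>" "\<And>x. x \<in> \<Lambda> \<Longrightarrow> x \<le> ?m" using fin ne by auto
      have "inner w (T w) \<le> (\<Sum>b\<in>B. ?m * (inner w b)\<^sup>2)" unfolding wTw
        by (intro sum_mono mult_right_mono m) (auto simp: \<Lambda>_def)
      also have "\<dots> = ?m" by (simp add: one flip: sum_distrib_left)
      finally have "\<rho> - ?m \<le> \<delta>" using d by linarith
      moreover have "?m \<le> \<rho>" using 1 m(1) by (metis (mono_tags, lifting) empty_iff mem_Collect_eq not_le_imp_less)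
      ultimately have "\<bar>\<rho> - ?m\<bar> \<le> \<epsilon>\<^sup>2 + \<delta>" by (simp add: add_increasing)
      then show ?thesis using KS m(1) by force
    next
      case 2
      let ?m = "Min \<Lambda>"
      have m: "?m \<in> \<Lambda>" "\<And>x. x \<in> \<Lambda> \<Longrightarrow> ?m \<le> x" using fin ne by auto
      have "?m = (\<Sum>b\<in>B. ?m * (inner w b)\<^sup>2)" by (simp add: one flip: sum_distrib_left)
      also have "\<dots> \<le> inner w (T w)" unfolding wTw
        by (intro sum_mono mult_right_mono m) (auto simp: \<Lambda>_def)
      finally have "?m - \<rho> \<le> \<delta>" using d by linarith
      moreover have "\<rho> \<le> ?m" using 2 m(1) by (metis (mono_tags, lifting) empty_iff mem_Collect_eq linear)
      ultimately have "\<bar>\<rho> - ?m\<bar> \<le> \<epsilon>\<^sup>2 + \<delta>" by (simp add: add_increasing)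
      then show ?thesis using KS m(1) by force
    next
      case 3
      define x y where "x = Max ?L" and "y = Min ?U"
      have x: "x \<in> \<Lambda>" "x \<le> \<rho>" and y: "y \<in> \<Lambda>" "\<rho> < y"
        using Max_in[of ?L] Min_in[of ?U] 3 fin by (auto simp: x_def y_def)
      have gap: "z \<le> x \<or> y \<le> z" if "z \<in> \<Lambda>" for z
        using that fin by (cases "z \<le> \<rho>") (auto simp: x_def y_def)
      \<comment> \<open>positivity of \<open>(T - x)(T - y)\<close>, tested at \<open>w\<close>\<close>
      have "0 \<le> (\<Sum>b\<in>B. ((l b - x) * (l b - y)) * (inner w b)\<^sup>2)"
      proof (rule sum_nonneg)
        fix b assume "b \<in> B"
        then have "l b \<le> x \<or> y \<le> l b" using gap by (simp add: \<Lambda>_def)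
        then have "0 \<le> (l b - x) * (l b - y)" using x y by (auto intro: mult_nonneg_nonneg mult_nonpos_nonpos)
        then show "0 \<le> ((l b - x) * (l b - y)) * (inner w b)\<^sup>2" by simp
      qed
      also have "\<dots> = (\<Sum>b\<in>B. (l b)\<^sup>2 * (inner w b)\<^sup>2) - (x + y) * (\<Sum>b\<in>B. l b * (inner w b)\<^sup>2) + x * y * (\<Sum>b\<in>B. (inner w b)\<^sup>2)"
        by (simp add: sum_distrib_left algebra_simps power2_eq_square flip: sum.distrib sum_subtractf)
      also have "\<dots> = inner (T w) (T w) - (x + y) * inner w (T w) + x * y"
        by (simp add: one flip: wTw TwTw)
      also have "\<dots> = (norm (T w - \<rho> *\<^sub>R w))\<^sup>2 + (2 * \<rho> - x - y) * (inner w (T w) - \<rho>) - (\<rho> - x) * (y - \<rho>)"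
        by (simp add: nrm) (simp add: algebra_simps power2_eq_square)
      finally have "(\<rho> - x) * (y - \<rho>) \<le> (norm (T w - \<rho> *\<^sub>R w))\<^sup>2 + (2 * \<rho> - x - y) * (inner w (T w) - \<rho>)"
        by simp
      also have "\<dots> \<le> \<epsilon>\<^sup>2 + D * \<delta>"
      proof (intro add_mono power_mono e norm_ge_zero)
        have "\<bar>2 * \<rho> - x - y\<bar> \<le> D" using D[OF x(1) y(1)] x y by linarith
        then have "\<bar>(2 * \<rho> - x - y) * (inner w (T w) - \<rho>)\<bar> \<le> D * \<delta>"
          unfolding abs_mult using d D0 by (intro mult_mono) auto
        then show "(2 * \<rho> - x - y) * (inner w (T w) - \<rho>) \<le> D * \<delta>" by linarith
      qed
      also have "\<dots> \<le> (1 + D) * (\<epsilon>\<^sup>2 + \<delta>)" using D0 d0 by (simp add: algebra_simps)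
      finally have prod: "(\<rho> - x) * (y - \<rho>) \<le> (1 + D) * (\<epsilon>\<^sup>2 + \<delta>)" .
      have gxy: "g \<le> y - x" using gle[OF x(1) y(1)] x y by simp
      have fact: "z \<le> K * (\<epsilon>\<^sup>2 + \<delta>)" if z: "0 \<le> z" "z * (g / 2) \<le> (1 + D) * (\<epsilon>\<^sup>2 + \<delta>)" for z
      proof -
        have "z \<le> 2 * (1 + D) / g * (\<epsilon>\<^sup>2 + \<delta>)" using z gpos by (simp add: field_simps)
        also have "\<dots> \<le> K * (\<epsilon>\<^sup>2 + \<delta>)" using d0 by (intro mult_right_mono) (auto simp: K_def)
        finally show ?thesis .
      qed
      show ?thesis
      proof (cases "\<rho> - x \<le> y - \<rho>")
        case True
        then have "(\<rho> - x) * (g / 2) \<le> (\<rho> - x) * (y - \<rho>)" using gxy x by (intro mult_left_mono) auto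
        also note prod
        finally have "\<rho> - x \<le> K * (\<epsilon>\<^sup>2 + \<delta>)" using x by (intro fact) simp_all
        then show ?thesis using x by (intro bexI[of _ x]) auto
      next
        case False
        then have "(y - \<rho>) * (g / 2) \<le> (y - \<rho>) * (\<rho> - x)" using gxy y by (intro mult_left_mono) auto
        also have "\<dots> \<le> (1 + D) * (\<epsilon>\<^sup>2 + \<delta>)" using prod by (simp only: mult.commute)
        finally have "y - \<rho> \<le> K * (\<epsilon>\<^sup>2 + \<delta>)" using y by (intro fact) simp_all
        then show ?thesis using y by (intro bexI[of _ y]) auto
      qed
    qed
  qed
  show ?thesis using fin K0 main by blast
qed

section \<open>Gradient and Hessian of the loss\<close>

definition residual :: "real ^ 'n ^ 'm \<Rightarrow> (real ^ 'r ^ 'm) \<times> (real ^ 'n ^ 'r) \<Rightarrow> real ^ 'n ^ 'm" where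
  "residual M z = fst z ** snd z - M"

definition loss_gradient ::
  "real ^ 'n ^ 'm \<Rightarrow> (real ^ 'r ^ 'm) \<times> (real ^ 'n ^ 'r) \<Rightarrow> (real ^ 'r ^ 'm) \<times> (real ^ 'n ^ 'r)" where
  "loss_gradient M z =
     (2 *\<^sub>R (residual M z ** transpose (snd z)), 2 *\<^sub>R (transpose (fst z) ** residual M z))"

text \<open>The derivative of \<open>(X, Y) \<mapsto> X Y\<close> at \<open>z\<close>.\<close>

definition product_derivative ::
  "(real ^ 'r ^ 'm) \<times> (real ^ 'n ^ 'r) \<Rightarrow> (real ^ 'r ^ 'm) \<times> (real ^ 'n ^ 'r) \<Rightarrow> real ^ 'n ^ 'm" where
  "product_derivative z d = fst z ** snd d + fst d ** snd z"

text \<open>The second derivative of the loss, as the self-adjoint operator that represents it.\<close>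

definition loss_hessian ::
  "real ^ 'n ^ 'm \<Rightarrow> (real ^ 'r ^ 'm) \<times> (real ^ 'n ^ 'r) \<Rightarrow>
     (real ^ 'r ^ 'm) \<times> (real ^ 'n ^ 'r) \<Rightarrow> (real ^ 'r ^ 'm) \<times> (real ^ 'n ^ 'r)" where
  "loss_hessian M z d =
     (2 *\<^sub>R (residual M z ** transpose (snd d) + product_derivative z d ** transpose (snd z)),
      2 *\<^sub>R (transpose (fst z) ** product_derivative z d + transpose (fst d) ** residual M z))"

lemma fact_loss_eq: "fact_loss M z = (norm (residual M z))\<^sup>2"
  by (cases z) (simp add: fact_loss_def residual_def)

lemma residual_has_derivative:
  "(residual M has_derivative product_derivative z) (at z)"
  unfolding residual_def product_derivative_def
  by (auto intro!: derivative_eq_intros matrix_mult.FDERIV)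

lemma has_derivative_transpose:
  "(f has_derivative f') F \<Longrightarrow> ((\<lambda>x. transpose (f x) :: real ^ 'b ^ 'a) has_derivative (\<lambda>x. transpose (f' x))) F"
  by (rule bounded_linear.has_derivative[OF bounded_linear_transpose])

lemma gradient_fact_loss: "gradient (fact_loss M) = loss_gradient M"
proof
  fix z
  have "((\<lambda>z. inner (residual M z) (residual M z)) has_derivative
          (\<lambda>d. inner (residual M z) (product_derivative z d) + inner (product_derivative z d) (residual M z))) (at z)"
    by (intro has_derivative_inner residual_has_derivative)
  moreover have "inner (residual M z) (product_derivative z d) + inner (product_derivative z d) (residual M z)
      = inner d (loss_gradient M z)" for d
    by (simp add: inner_commute[of "residual M z"] product_derivative_def inner_add_left loss_gradient_def
        inner_Pair_0 inner_prod_def inner_matrix_mult_left_factor[of "fst d"] inner_matrix_mult_right_factor[of _ "snd d"])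
  ultimately have "GDERIV (fact_loss M) z :> loss_gradient M z"
    by (simp add: gderiv_def fact_loss_eq[abs_def] power2_norm_eq_inner)
  then show "gradient (fact_loss M) z = loss_gradient M z" by (rule gradient_eqI)
qed

lemma loss_gradient_has_derivative:
  "(loss_gradient M has_derivative loss_hessian M z) (at z)"
  unfolding loss_gradient_def[abs_def] loss_hessian_def[abs_def]
  by (intro has_derivative_Pair has_derivative_scaleR_right matrix_mult.FDERIV residual_has_derivative
        has_derivative_transpose has_derivative_fst has_derivative_snd has_derivative_ident)

lemma continuous_on_transpose:
  "continuous_on S f \<Longrightarrow> continuous_on S (\<lambda>x. transpose (f x) :: real ^ 'b ^ 'a)"
  by (rule bounded_linear.continuous_on[OF bounded_linear_transpose])

lemma continuous_on_residual: "continuous_on S (residual M)"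
  unfolding residual_def by (intro continuous_intros matrix_mult.continuous_on)

lemma continuous_on_loss_gradient: "continuous_on S (loss_gradient M)"
  unfolding loss_gradient_def
  by (intro continuous_intros matrix_mult.continuous_on continuous_on_transpose continuous_on_residual)

lemma continuous_on_loss_hessian: "continuous_on S (\<lambda>z. loss_hessian M z d)"
  unfolding loss_hessian_def product_derivative_def
  by (intro continuous_intros matrix_mult.continuous_on continuous_on_transpose continuous_on_residual)

lemma inner_mult_transpose_right:
  fixes A :: "real ^ 'b ^ 'a" and B :: "real ^ 'c ^ 'b" and C :: "real ^ 'c ^ 'a"
  shows "inner (C ** transpose B) A = inner (A ** B) C"
  by (metis inner_matrix_mult_left_factor inner_commute)

lemma inner_transpose_mult_left:
  fixes A :: "real ^ 'b ^ 'a" and B :: "real ^ 'c ^ 'b" and C :: "real ^ 'c ^ 'a"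
  shows "inner (transpose A ** C) B = inner (A ** B) C"
  by (metis inner_matrix_mult_right_factor inner_commute)

text \<open>The Hessian form is \<open>2 \<langle>Dd, Dd'\<rangle>\<close>, with \<open>D\<close> the derivative of the product, plus a curvature term
  in which the residual meets the bilinear part of the product. Only the latter can be negative.\<close>

lemma inner_loss_hessian:
  "inner (loss_hessian M z d) d' =
     2 * inner (product_derivative z d) (product_derivative z d')
     + 2 * inner (residual M z) (fst d' ** snd d) + 2 * inner (residual M z) (fst d ** snd d')"
  by (simp add: loss_hessian_def inner_prod_def inner_add_left inner_add_right algebra_simps
      inner_mult_transpose_right inner_transpose_mult_left product_derivative_def[of z d']
      inner_commute[of "residual M z"] inner_commute[of "product_derivative z d"])

lemma loss_hessian_selfadjoint: "inner (loss_hessian M z d) d' = inner d (loss_hessian M z d')"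
  by (simp add: inner_loss_hessian inner_commute[of d] inner_commute[of "product_derivative z d"])

lemma linear_loss_hessian: "linear (loss_hessian M z)"
  using loss_gradient_has_derivative by (rule has_derivative_linear)

section \<open>Second-order critical points are global minima\<close>

text \<open>The vector \<open>v\<close> maximizes \<open>\<parallel>E v\<parallel>\<close> on the sphere. That \<open>E\<^sup>T E v = s\<^sup>2 v\<close> needs no variation of \<open>v\<close>: expand
  \<open>\<parallel>E\<^sup>T E v - s\<^sup>2 v\<parallel>\<^sup>2\<close> and use that \<open>E\<^sup>T\<close> has norm at most \<open>s\<close>, too.\<close>

lemma top_singular_pair:
  fixes E :: "real ^ 'n ^ 'm"
  assumes "E \<noteq> 0"
  obtains s u v where "s > 0" "norm u = 1" "norm v = 1" "E *v v = s *\<^sub>R u" "transpose E *v u = s *\<^sub>R v"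
    "\<forall>x. norm (E *v x) \<le> s * norm x" "\<forall>y. norm (transpose E *v y) \<le> s * norm y"
proof -
  define s where "s = onorm ((*v) E)"
  have le: "norm (E *v x) \<le> s * norm x" for x
    unfolding s_def by (rule onorm) simp
  have "\<exists>x. E *v x \<noteq> 0" using assms matrix_eq[of E 0] by auto
  then obtain x where "E *v x \<noteq> 0" by blast
  then have "0 < norm (E *v x)" by simp
  then have "s * norm x > 0" using le[of x] by linarith
  then have spos: "s > 0" by (simp add: zero_less_mult_iff)
  have "continuous_on (sphere 0 1) (\<lambda>v. norm (E *v v))"
    by (intro continuous_intros linear_continuous_on) simp
  moreover have "sphere (0::real^'n) 1 \<noteq> {}" by simp
  ultimately obtain v where v: "v \<in> sphere 0 1" and max: "\<And>w. w \<in> sphere 0 1 \<Longrightarrow> norm (E *v w) \<le> norm (E *v v)"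
    using continuous_attains_sup[OF compact_sphere] by blast
  have nv: "norm v = 1" using v by simp
  have "norm (E *v w) \<le> norm (E *v v) * norm w" for w
  proof (cases "w = 0")
    case False
    then have "w /\<^sub>R norm w \<in> sphere 0 1" by simp
    from max[OF this] show ?thesis using False by (simp add: matrix_vector_mult_scaleR field_simps)
  qed simp
  then have "s \<le> norm (E *v v)" unfolding s_def by (rule onorm_le)
  then have sv: "norm (E *v v) = s" using le[of v] nv by simp
  have leT: "norm (transpose E *v y) \<le> s * norm y" for y
  proof -
    let ?t = "transpose E *v y"
    have "(norm ?t)\<^sup>2 = inner y (E *v ?t)"
      unfolding power2_norm_eq_inner by (rule inner_transpose_mult_vector)
    also have "\<dots> \<le> norm y * (s * norm ?t)"
      by (rule order_trans[OF norm_cauchy_schwarz mult_left_mono[OF le]]) simp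
    finally have "norm ?t * norm ?t \<le> (s * norm y) * norm ?t" by (simp add: power2_eq_square algebra_simps)
    then show ?thesis using spos by (cases "norm ?t = 0") auto
  qed
  let ?w = "transpose E *v (E *v v)"
  have "(norm (?w - s\<^sup>2 *\<^sub>R v))\<^sup>2 = (norm ?w)\<^sup>2 - 2 * s\<^sup>2 * inner ?w v + s\<^sup>2 * s\<^sup>2 * (norm v)\<^sup>2"
    by (subst norm_diff_scaleR_square) (simp add: power2_eq_square del: transpose_matrix_vector)
  moreover have "inner ?w v = s\<^sup>2" using sv by (metis inner_transpose_mult_vector power2_norm_eq_inner)
  moreover have "(norm ?w)\<^sup>2 \<le> (s * s)\<^sup>2" using leT[of "E *v v"] sv by (intro power_mono) auto
  ultimately have "(norm (?w - s\<^sup>2 *\<^sub>R v))\<^sup>2 \<le> 0" using nv by (simp add: power2_eq_square)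
  then have w: "?w = s\<^sup>2 *\<^sub>R v" by (simp del: transpose_matrix_vector)
  show ?thesis
  proof (rule that[of s "(1/s) *\<^sub>R (E *v v)" v])
    show "transpose E *v ((1/s) *\<^sub>R (E *v v)) = s *\<^sub>R v"
      using w spos by (simp add: matrix_vector_mult_scaleR power2_eq_square del: transpose_matrix_vector)
  qed (use spos nv sv le leT in \<open>auto simp del: transpose_matrix_vector\<close>)
qed

lemma orthonormal_projection:
  fixes C :: "'a::euclidean_space set"
  assumes C0: "pairwise orthogonal C" "\<forall>c\<in>C. norm c = 1" and fin: "finite C"
  defines "P \<equiv> \<lambda>x. \<Sum>c\<in>C. inner x c *\<^sub>R c"
  shows "P x \<in> span C" "\<And>y. y \<in> span C \<Longrightarrow> inner (x - P x) y = 0"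
    "(norm (P x))\<^sup>2 = (\<Sum>c\<in>C. (inner x c)\<^sup>2)" "(norm (x - P x))\<^sup>2 = (norm x)\<^sup>2 - (norm (P x))\<^sup>2"
proof -
  have C: "pairwise orthogonal C" "\<And>c. c \<in> C \<Longrightarrow> norm c = 1" using C0 by auto
  show 1: "P x \<in> span C" unfolding P_def by (intro span_sum span_scale span_base)
  have c: "inner (P x) c = inner x c" if "c \<in> C" for c
  proof -
    have "inner (P x) c = (\<Sum>a\<in>C. inner x a * inner a c)" by (simp add: P_def inner_sum_left)
    also have "\<dots> = (\<Sum>a\<in>C. if a = c then inner x c else 0)"
      using C that by (intro sum.cong) (auto simp: pairwise_def orthogonal_def dot_square_norm)
    finally show ?thesis using fin that by simp
  qed
  show 2: "inner (x - P x) y = 0" if "y \<in> span C" for y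
  proof -
    have "y = (\<Sum>c\<in>C. inner y c *\<^sub>R c)" by (rule orthonormal_expansion[OF C that])
    also have "inner (x - P x) \<dots> = 0" by (simp add: inner_sum_right inner_diff_left c)
    finally show ?thesis .
  qed
  show "(norm (P x))\<^sup>2 = (\<Sum>c\<in>C. (inner x c)\<^sup>2)"
    using orthonormal_Parseval[OF C 1, of "P x"]
    by (simp add: c flip: power2_eq_square power2_norm_eq_inner)
  have "inner x (P x) = inner (P x) (P x)" using 2[OF 1] by (simp add: inner_diff_left)
  then show "(norm (x - P x))\<^sup>2 = (norm x)\<^sup>2 - (norm (P x))\<^sup>2"
    using norm_diff_scaleR_square[of x 1 "P x"] by (simp add: power2_norm_eq_inner)
qed

text \<open>A sufficient condition for \<open>W = X Y\<close> to be a best approximation of rank at most \<open>r\<close> to \<open>W + E\<close>: the column and row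
  spaces of \<open>W\<close> and \<open>E\<close> are orthogonal, and \<open>s\<close> separates the singular values of \<open>E\<close> from the \<open>r\<close>
  singular values of \<open>W\<close>. Let \<open>P\<close> be the projection onto the range of \<open>X\<close>. The quadratic form
  \<open>\<parallel>W\<^sup>T q\<parallel>\<^sup>2 - s\<^sup>2 \<parallel>P q\<parallel>\<^sup>2\<close> is nonnegative, so its sum over an orthonormal basis of the column space of a
  competitor \<open>X' Y'\<close> is at most its full trace \<open>\<parallel>W\<parallel>\<^sup>2 - s\<^sup>2 r\<close>. Since
  \<open>\<parallel>E\<^sup>T q\<parallel>\<^sup>2 \<le> s\<^sup>2 (1 - \<parallel>P q\<parallel>\<^sup>2)\<close>, the part of \<open>W + E\<close> in at most \<open>r\<close> dimensions has squared norm at most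
  \<open>\<parallel>W\<parallel>\<^sup>2\<close>, and at least \<open>\<parallel>E\<parallel>\<^sup>2\<close> remains outside.\<close>

lemma Eckart_Young_certificate:
  fixes X X' :: "real ^ 'r ^ 'm" and Y Y' :: "real ^ 'n ^ 'r" and E :: "real ^ 'n ^ 'm"
  assumes XE: "transpose X ** E = 0" and EY: "E ** transpose Y = 0"
    and inj: "\<And>b. X *v b = 0 \<Longrightarrow> b = 0"
    and s: "s \<ge> 0" and sE: "\<And>y. norm (transpose E *v y) \<le> s * norm y"
    and sW: "\<And>b. s * norm (X *v b) \<le> norm (transpose (X ** Y) *v (X *v b))"
  shows "(norm E)\<^sup>2 \<le> (norm (X ** Y + E - X' ** Y'))\<^sup>2"
proof -
  note [simp del] = transpose_matrix_vector
  define W where "W = X ** Y"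
  let ?M = "W + E" and ?Z = "X' ** Y'"
  have sub: "subspace (range ((*v) X))" "subspace (range ((*v) X'))"
    by (simp_all add: linear_subspace_image)
  obtain C where C: "C \<subseteq> range ((*v) X)" "pairwise orthogonal C" "\<And>c. c \<in> C \<Longrightarrow> norm c = 1"
    "independent C" "card C = dim (range ((*v) X))" "span C = range ((*v) X)"
    using orthonormal_basis_subspace[OF sub(1)] by blast
  obtain B where B: "B \<subseteq> range ((*v) X')" "pairwise orthogonal B" "\<And>c. c \<in> B \<Longrightarrow> norm c = 1"
    "independent B" "card B = dim (range ((*v) X'))" "span B = range ((*v) X')"
    using orthonormal_basis_subspace[OF sub(2)] by blast
  have finC: "finite C" using C(4) by (rule independent_imp_finite)
  obtain B' where B': "B \<subseteq> B'" "pairwise orthogonal B'" "\<And>b. b \<in> B' \<Longrightarrow> norm b = 1" "span B' = UNIV" "finite B'"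
    using orthonormal_extends_to_basis[OF B(2,3)] by blast
  have "inj ((*v) X)" using inj by (simp add: linear_injective_0)
  then have cardC: "card C = CARD('r)"
    using dim_image_eq[of "(*v) X" UNIV] C(5) by simp
  have cardB: "card B \<le> CARD('r)"
    using dim_image_le[of "(*v) X'" UNIV] B(5) by simp
  have sumsq: "(norm A)\<^sup>2 = (\<Sum>q\<in>B'. (norm (transpose A *v q))\<^sup>2)" for A :: "real ^ 'n ^ 'm"
    using norm_matrix_orthonormal[OF B'(2-4), of "transpose A"] by simp
  \<comment> \<open>orthogonality of the column and row spaces makes the squared norms of \<open>W\<^sup>T q\<close> and \<open>E\<^sup>T q\<close> add up\<close>
  have WE: "W ** transpose E = 0"
  proof -
    have "Y ** transpose E = transpose (E ** transpose Y)" by (simp add: matrix_transpose_mul)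
    then show ?thesis unfolding W_def by (simp add: EY flip: matrix_mul_assoc)
  qed
  have pyth: "(norm (transpose ?M *v q))\<^sup>2 = (norm (transpose W *v q))\<^sup>2 + (norm (transpose E *v q))\<^sup>2" for q
  proof -
    have "inner (transpose W *v q) (transpose E *v q) = inner q ((W ** transpose E) *v q)"
      by (simp add: inner_transpose_mult_vector flip: matrix_vector_mul_assoc)
    then have "inner (transpose W *v q) (transpose E *v q) = 0" by (simp add: WE)
    then show ?thesis
      by (simp add: transpose_add matrix_vector_mult_add_rdistrib norm_add_Pythagorean orthogonal_def)
  qed
  define P where "P x = (\<Sum>c\<in>C. inner x c *\<^sub>R c)" for x
  have "\<forall>c\<in>C. norm c = 1" using C(3) by blast
  note P = orthonormal_projection[OF C(2) this finC, folded P_def]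
  have Xorth: "transpose X *v (x - P x) = 0" for x
  proof -
    have "inner (transpose X *v (x - P x)) b = 0" for b
      unfolding inner_transpose_mult_vector by (rule P(2)) (simp_all add: C(6))
    then show ?thesis by (metis inner_eq_zero_iff)
  qed
  have h: "s\<^sup>2 * (norm (P q))\<^sup>2 \<le> (norm (transpose W *v q))\<^sup>2" for q
  proof -
    obtain b where b: "P q = X *v b" using P(1)[of q] C(6) by auto
    have "transpose W *v (q - P q) = transpose Y *v (transpose X *v (q - P q))"
      by (simp add: W_def matrix_transpose_mul matrix_vector_mul_assoc)
    also have "\<dots> = 0" by (simp only: Xorth matrix_vector_mult_0_right)
    finally have "transpose W *v q = transpose W *v P q"
      by (simp add: matrix_vector_mult_diff_distrib)
    moreover have "(s * norm (P q))\<^sup>2 \<le> (norm (transpose W *v P q))\<^sup>2"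
      unfolding b W_def using s by (intro power_mono sW) auto
    ultimately show ?thesis by (simp add: power_mult_distrib)
  qed
  have e: "(norm (transpose E *v q))\<^sup>2 \<le> s\<^sup>2 * (1 - (norm (P q))\<^sup>2)" if "q \<in> B'" for q
  proof -
    obtain b where b: "P q = X *v b" using P(1)[of q] C(6) by auto
    have "transpose E *v P q = transpose (transpose X ** E) *v b"
      by (simp add: b matrix_transpose_mul matrix_vector_mul_assoc)
    also have "\<dots> = 0" by (simp add: XE)
    finally have "transpose E *v q = transpose E *v (q - P q)"
      by (simp add: matrix_vector_mult_diff_distrib)
    then have "(norm (transpose E *v q))\<^sup>2 \<le> (s * norm (q - P q))\<^sup>2"
      by (auto intro!: power_mono sE)
    then show ?thesis by (simp add: power_mult_distrib P(4) B'(3)[OF that])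
  qed
  have sumP: "(\<Sum>q\<in>B'. (norm (P q))\<^sup>2) = CARD('r)"
  proof -
    have "(\<Sum>q\<in>B'. (norm (P q))\<^sup>2) = (\<Sum>c\<in>C. \<Sum>q\<in>B'. (inner q c)\<^sup>2)"
      unfolding P(3) by (rule sum.swap)
    also have "\<dots> = (\<Sum>c\<in>C. 1)"
    proof (rule sum.cong)
      fix c assume "c \<in> C"
      then show "(\<Sum>q\<in>B'. (inner q c)\<^sup>2) = 1"
        using orthonormal_Parseval[OF B'(2,3), of c c] C(3)[of c]
        by (simp add: B'(4) dot_square_norm inner_commute power2_eq_square)
    qed simp
    finally show ?thesis by (simp add: cardC)
  qed
  have "(\<Sum>q\<in>B. (norm (transpose ?M *v q))\<^sup>2)
      \<le> (\<Sum>q\<in>B. ((norm (transpose W *v q))\<^sup>2 - s\<^sup>2 * (norm (P q))\<^sup>2) + s\<^sup>2)"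
  proof (rule sum_mono)
    fix q assume "q \<in> B"
    then have "q \<in> B'" using B'(1) by blast
    from e[OF this] show "(norm (transpose ?M *v q))\<^sup>2
        \<le> (norm (transpose W *v q))\<^sup>2 - s\<^sup>2 * (norm (P q))\<^sup>2 + s\<^sup>2"
      unfolding pyth by (simp add: algebra_simps)
  qed
  also have "\<dots> = (\<Sum>q\<in>B. (norm (transpose W *v q))\<^sup>2 - s\<^sup>2 * (norm (P q))\<^sup>2) + card B * s\<^sup>2"
    by (simp add: sum.distrib)
  also have "\<dots> \<le> (\<Sum>q\<in>B'. (norm (transpose W *v q))\<^sup>2 - s\<^sup>2 * (norm (P q))\<^sup>2) + CARD('r) * s\<^sup>2"
    by (intro add_mono sum_mono2 mult_right_mono B') (use h cardB in auto)
  also have "\<dots> = (norm W)\<^sup>2"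
    by (simp add: sum_subtractf sumP flip: sum_distrib_left sumsq)
  finally have top: "(\<Sum>q\<in>B. (norm (transpose ?M *v q))\<^sup>2) \<le> (norm W)\<^sup>2" .
  have "(norm W)\<^sup>2 + (norm E)\<^sup>2 = (\<Sum>q\<in>B'. (norm (transpose ?M *v q))\<^sup>2)"
    by (simp add: pyth sumsq sum.distrib)
  also have "\<dots> = (\<Sum>q\<in>B'-B. (norm (transpose ?M *v q))\<^sup>2) + (\<Sum>q\<in>B. (norm (transpose ?M *v q))\<^sup>2)"
    by (rule sum.subset_diff) (use B' in auto)
  also have "(\<Sum>q\<in>B'-B. (norm (transpose ?M *v q))\<^sup>2) = (\<Sum>q\<in>B'-B. (norm (transpose (?M - ?Z) *v q))\<^sup>2)"
  proof (rule sum.cong)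
    fix q assume q: "q \<in> B' - B"
    have "inner q x = 0" if "x \<in> span B" for x
    proof (rule span_induct[OF that])
      show "inner q b = 0" if "b \<in> B" for b
      proof -
        have "b \<in> B'" "q \<in> B'" "q \<noteq> b" using B'(1) q that by auto
        then show ?thesis using B'(2) by (simp add: pairwise_def orthogonal_def)
      qed
    qed (rule subspace_hyperplane)
    then have "inner q (X' *v b) = 0" for b by (simp add: B(6))
    then have "transpose X' *v q = 0" by (metis inner_eq_zero_iff inner_transpose_mult_vector)
    then have "transpose ?Z *v q = 0"
      by (simp add: matrix_transpose_mul flip: matrix_vector_mul_assoc)
    then show "(norm (transpose ?M *v q))\<^sup>2 = (norm (transpose (?M - ?Z) *v q))\<^sup>2"
      by (simp only: transpose_diff matrix_vector_mult_diff_rdistrib) simp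
  qed simp
  also have "\<dots> \<le> (norm (?M - ?Z))\<^sup>2"
    unfolding sumsq by (rule sum_mono2) (use B' in auto)
  finally show ?thesis using top unfolding W_def by linarith
qed

lemma loss_gradient_eq_0_iff:
  "loss_gradient M z = 0 \<longleftrightarrow>
     residual M z ** transpose (snd z) = 0 \<and> transpose (fst z) ** residual M z = 0"
  by (simp add: loss_gradient_def zero_prod_def)

text \<open>Curvature is tested only in directions \<open>(M U, V)\<close>, that is, inside the invariant set. The direction
  \<open>(u a\<^sup>T, b v\<^sup>T)\<close> for a top singular pair of \<open>E = M - X Y\<close> is one of them, because \<open>u = M (v / s)\<close>
  at a critical point. Its curvature is a positive multiple of \<open>\<parallel>X b\<parallel>\<^sup>2 + \<parallel>Y\<^sup>T a\<parallel>\<^sup>2 - 2 s \<langle>a, b\<rangle>\<close>, and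
  nonnegativity for all \<open>a\<close> and \<open>b\<close> yields the hypotheses of the Eckart-Young certificate.\<close>

theorem second_order_critical_imp_global_min:
  fixes M :: "real ^ 'n ^ 'm" and A :: "real ^ 'r ^ 'n" and Y :: "real ^ 'n ^ 'r"
  defines "z \<equiv> (M ** A, Y)"
  assumes crit: "loss_gradient M z = 0"
    and psd: "\<And>U V. inner (loss_hessian M z (M ** U, V)) (M ** U, V) \<ge> 0"
  shows "is_global_min (fact_loss M) z"
proof (cases "residual M z = 0")
  case True
  then show ?thesis by (simp add: is_global_min_def fact_loss_eq)
next
  case False
  note [simp del] = transpose_matrix_vector
  define X where "X = M ** A"
  define E where "E = - residual M z"
  have E0: "E \<noteq> 0" using False by (simp add: E_def)
  have M: "M = X ** Y + E" by (simp add: E_def residual_def z_def X_def)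
  have XE: "transpose X ** E = 0" and EY: "E ** transpose Y = 0"
    using crit by (simp_all add: loss_gradient_eq_0_iff E_def matrix_mult.minus_left matrix_mult.minus_right z_def X_def)
  obtain s u v where s: "s > 0" and u: "norm u = 1" and v: "norm v = 1"
    and Ev: "E *v v = s *\<^sub>R u" and Eu: "transpose E *v u = s *\<^sub>R v"
    and leT: "\<forall>y. norm (transpose E *v y) \<le> s * norm y"
    using top_singular_pair[OF E0] by metis
  have "s *\<^sub>R (transpose X *v u) = (transpose X ** E) *v v"
    by (simp add: Ev matrix_vector_mult_scaleR flip: matrix_vector_mul_assoc)
  then have Xu: "transpose X *v u = 0" using s by (simp add: XE)
  have "s *\<^sub>R (Y *v v) = transpose (E ** transpose Y) *v u"
    by (simp add: Eu matrix_vector_mult_scaleR matrix_transpose_mul flip: matrix_vector_mul_assoc)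
  then have Yv: "Y *v v = 0" using s by (simp add: EY)
  have Mv: "M *v ((1/s) *\<^sub>R v) = u"
    using s by (simp add: M matrix_vector_mult_scaleR matrix_vector_mult_add_rdistrib Ev Yv flip: matrix_vector_mul_assoc)
  have ineq: "2 * s * inner a b \<le> (norm (X *v b))\<^sup>2 + (norm (transpose Y *v a))\<^sup>2" for a b
  proof -
    define d where "d = (outer u a, outer b v)"
    have "0 \<le> inner (loss_hessian M z d) d"
      using psd[of "outer ((1/s) *\<^sub>R v) a" "outer b v"] by (simp add: d_def matrix_mult_outer Mv)
    also have "\<dots> = 2 * (norm (product_derivative z d))\<^sup>2 + 4 * inner (residual M z) (fst d ** snd d)"
      by (simp add: inner_loss_hessian power2_norm_eq_inner)
    also have "inner (residual M z) (fst d ** snd d) = - s * inner a b"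
    proof -
      have "inner E (fst d ** snd d) = inner a b * s"
        using u by (simp add: d_def matrix_mult_outer outer_mult_vector inner_outer Ev dot_square_norm)
      moreover have "inner E (fst d ** snd d) = - inner (residual M z) (fst d ** snd d)"
        by (simp add: E_def)
      ultimately show ?thesis by (simp add: algebra_simps)
    qed
    also have "(norm (product_derivative z d))\<^sup>2 = (norm (X *v b))\<^sup>2 + (norm (transpose Y *v a))\<^sup>2"
    proof -
      have pd: "product_derivative z d = outer (X *v b) v + outer u (transpose Y *v a)"
        by (simp add: product_derivative_def d_def z_def X_def matrix_mult_outer outer_matrix_mult)
      have o: "inner (outer p q) (outer p' q') = inner p p' * inner q q'"
        for p p' :: "real ^ 'm" and q q' :: "real ^ 'n"
        by (simp add: inner_outer outer_mult_vector inner_commute)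
      have "inner u (X *v b) = 0" by (metis Xu inner_transpose_mult_vector inner_zero_left)
      then have "orthogonal (outer (X *v b) v) (outer u (transpose Y *v a))"
        by (simp add: orthogonal_def o inner_commute[of "X *v b"])
      moreover have "(norm (outer p q))\<^sup>2 = (norm p)\<^sup>2 * (norm q)\<^sup>2" for p :: "real ^ 'm" and q :: "real ^ 'n"
        unfolding power2_norm_eq_inner by (rule o)
      ultimately show ?thesis
        using u v by (simp add: pd norm_add_Pythagorean)
    qed
    finally show ?thesis by simp
  qed
  show ?thesis
  proof -
    have inj: "b = 0" if b: "X *v b = 0" for b
    proof (rule ccontr)
      assume "b \<noteq> 0"
      define c where "c = (norm (transpose Y *v b))\<^sup>2"
      \<comment> \<open>for small \<open>t\<close> the direction given by \<open>a = t b\<close> would have negative curvature\<close>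
      define t where "t = s * (norm b)\<^sup>2 / (c + 1)"
      have c: "c \<ge> 0" by (simp add: c_def)
      have t: "t > 0" using s \<open>b \<noteq> 0\<close> c by (simp add: t_def add_nonneg_pos)
      have "2 * s * (t * (norm b)\<^sup>2) \<le> t\<^sup>2 * c"
        using ineq[of "t *\<^sub>R b" b] b
        by (simp add: matrix_vector_mult_scaleR power_mult_distrib c_def dot_square_norm)
      then have "t * (2 * s * (norm b)\<^sup>2) \<le> t * (t * c)" by (simp add: power2_eq_square algebra_simps)
      then have "2 * s * (norm b)\<^sup>2 \<le> t * c" using t by simp
      also have "\<dots> \<le> t * (c + 1)" using t by simp
      also have "\<dots> = s * (norm b)\<^sup>2" using c by (simp add: t_def)
      finally show False using s \<open>b \<noteq> 0\<close> by simp
    qed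
    have sW: "s * norm (X *v b) \<le> norm (transpose (X ** Y) *v (X *v b))" for b
    proof -
      let ?a = "transpose X *v (X *v b)"
      have a: "inner ?a b = (norm (X *v b))\<^sup>2" by (simp add: inner_transpose_mult_vector power2_norm_eq_inner)
      have W: "transpose Y *v ?a = transpose (X ** Y) *v (X *v b)"
        by (simp add: matrix_transpose_mul matrix_vector_mul_assoc matrix_mul_assoc)
      \<comment> \<open>the scaling \<open>1 / s\<close> of \<open>X\<^sup>T X b\<close> turns the mixed term into \<open>2 \<parallel>X b\<parallel>\<^sup>2\<close>\<close>
      have "2 * (norm (X *v b))\<^sup>2 \<le> (norm (X *v b))\<^sup>2 + (norm (transpose Y *v ?a))\<^sup>2 / s\<^sup>2"
        using ineq[of "(1/s) *\<^sub>R ?a" b] s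
        by (simp add: a matrix_vector_mult_scaleR power_mult_distrib power_divide)
      then have "(s * norm (X *v b))\<^sup>2 \<le> (norm (transpose Y *v ?a))\<^sup>2"
        using s by (simp add: field_simps power_mult_distrib)
      then show ?thesis unfolding W by (rule power2_le_imp_le) simp
    qed
    have "(norm E)\<^sup>2 \<le> (norm (X ** Y + E - fst y ** snd y))\<^sup>2" for y :: "(real ^ 'r ^ 'm) \<times> (real ^ 'n ^ 'r)"
      using Eckart_Young_certificate[OF XE EY inj _ leT[rule_format] sW] s by simp
    moreover have "residual M y = - (X ** Y + E - fst y ** snd y)"
      for y :: "(real ^ 'r ^ 'm) \<times> (real ^ 'n ^ 'r)"
      unfolding M[symmetric] by (simp add: residual_def)
    moreover have "norm (residual M z) = norm E" by (simp add: E_def)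
    ultimately show ?thesis by (simp only: is_global_min_def fact_loss_eq norm_minus_cancel simp_thms)
  qed
qed

section \<open>A Lojasiewicz inequality with exponent one half\<close>

lemma linear_Gram:
  fixes A :: "real ^ 'b ^ 'a"
  shows "linear (\<lambda>x. transpose A *v (A *v x))"
  by (intro linearI) (simp_all add: matrix_vector_right_distrib matrix_vector_mult_scaleR del: transpose_matrix_vector)

lemma Gram_selfadjoint:
  fixes A :: "real ^ 'b ^ 'a"
  shows "inner (transpose A *v (A *v x)) y = inner x (transpose A *v (A *v y))"
proof -
  have "inner x (transpose A *v (A *v y)) = inner (A *v y) (A *v x)"
    by (metis inner_commute inner_transpose_mult_vector)
  then show ?thesis by (metis inner_commute inner_transpose_mult_vector)
qed

lemma Gram_minus:
  fixes A :: "real ^ 'b ^ 'a"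
  shows "transpose (- A) *v ((- A) *v x) = transpose A *v (A *v x)"
  by (simp add: vec_eq_iff matrix_vector_mult_def transpose_def sum_negf del: transpose_matrix_vector)

text \<open>The constant is the smallest nonzero singular value of \<open>M\<close>. On the whole
  space no such bound holds when \<open>M\<close> lacks full row rank; here the restriction to the range of \<open>M\<close> pays off.\<close>

lemma transpose_bounded_below_on_range:
  fixes M :: "real ^ 'n ^ 'm"
  obtains \<sigma> where "\<sigma> > 0" "\<forall>x. \<sigma> * norm (M *v x) \<le> norm (transpose M *v (M *v x))"
proof -
  have "\<exists>e>0. \<forall>x\<in>range ((*v) M). norm (transpose M *v x) \<ge> e * norm x"
  proof (rule injective_imp_isometric)
    show "closed (range ((*v) M))" "subspace (range ((*v) M))"
      by (simp_all add: linear_subspace_image closed_subspace)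
    show "bounded_linear ((*v) (transpose M))" by (simp del: transpose_matrix_vector)
    show "\<forall>x\<in>range ((*v) M). transpose M *v x = 0 \<longrightarrow> x = 0"
      by (metis (no_types, lifting) imageE inner_eq_zero_iff inner_transpose_mult_vector inner_zero_left)
  qed
  then show ?thesis using that by blast
qed

text \<open>With \<open>s = \<parallel>E b\<parallel>\<close>, the eigenvalue of \<open>E\<^sup>T E\<close> at \<open>b\<close> is \<open>s\<^sup>2\<close>. If \<open>s\<close> is small compared with the lower bound
  \<open>\<sigma>\<close> of \<open>M\<^sup>T\<close> on the range of \<open>M\<close>, which contains \<open>E b\<close>, then \<open>M\<^sup>T E b = s\<^sup>2 b + Y\<^sup>T X\<^sup>T E b\<close> forces
  \<open>s = O(\<epsilon>)\<close>. Otherwise \<open>Y b = s\<^sup>-\<^sup>2 (E Y\<^sup>T)\<^sup>T E b = O(\<epsilon>)\<close>, so \<open>b\<close> is nearly an eigenvector of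
  \<open>M\<^sup>T M\<close>; moreover \<open>\<parallel>M b\<parallel>\<^sup>2\<close> differs from \<open>s\<^sup>2\<close> only by \<open>O(\<epsilon>\<^sup>2)\<close>, because the cross term is
  \<open>2 \<langle>X\<^sup>T E b, Y b\<rangle>\<close>, a product of two quantities of order \<open>\<epsilon>\<close>.\<close>

lemma residual_eigenvalue_near_spectrum:
  fixes M :: "real ^ 'n ^ 'm" and R :: real
  shows "\<exists>\<Lambda> K. finite \<Lambda> \<and> K \<ge> 0 \<and>
    (\<forall>(A :: real ^ 'r ^ 'n) Y \<rho> b. norm (M ** A, Y) \<le> R \<longrightarrow> norm b = 1 \<longrightarrow>
       transpose (residual M (M ** A, Y)) *v (residual M (M ** A, Y) *v b) = \<rho> *\<^sub>R b \<longrightarrow>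
       (\<exists>l\<in>\<Lambda>. \<bar>\<rho> - l\<bar> \<le> K * (norm (loss_gradient M (M ** A, Y)))\<^sup>2))"
proof -
  note [simp del] = transpose_matrix_vector
  obtain \<sigma> where \<sigma>: "\<sigma> > 0" "\<forall>x. \<sigma> * norm (M *v x) \<le> norm (transpose M *v (M *v x))"
    by (rule transpose_bounded_below_on_range)
  define T where "T x = transpose M *v (M *v x)" for x
  have linT: "linear T" and saT: "\<And>x y. inner (T x) y = inner x (T y)"
    unfolding T_def by (rule linear_Gram, rule Gram_selfadjoint)
  obtain \<Lambda> K0 where \<Lambda>: "finite \<Lambda>" and K0: "K0 > 0" and near:
    "\<And>w \<rho> \<epsilon> \<delta>. norm w = 1 \<Longrightarrow> norm (T w - \<rho> *\<^sub>R w) \<le> \<epsilon> \<Longrightarrow>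
     \<bar>inner w (T w) - \<rho>\<bar> \<le> \<delta> \<Longrightarrow> \<exists>l\<in>\<Lambda>. \<bar>\<rho> - l\<bar> \<le> K0 * (\<epsilon>\<^sup>2 + \<delta>)"
    using Rayleigh_quotient_near_eigenvalue[OF linT saT] by blast
  \<comment> \<open>\<open>K2\<close> bounds the residual of \<open>b\<close> and \<open>K3\<close> the error of its Rayleigh quotient, in units of \<open>\<epsilon>\<close> and \<open>\<epsilon>\<^sup>2\<close>\<close>
  define K2 K3 where "K2 = 2 * R + R * R * R * (2 / \<sigma>)" and "K3 = 4 / \<sigma> + (R * (2 / \<sigma>))\<^sup>2"
  define K where "K = (2 * R / \<sigma>)\<^sup>2 + K0 * (K2\<^sup>2 + K3)"
  have K3: "K3 \<ge> 0" unfolding K3_def using \<sigma>(1) by simp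
  have K: "K \<ge> 0" "(2 * R / \<sigma>)\<^sup>2 \<le> K" "K0 * (K2\<^sup>2 + K3) \<le> K"
    unfolding K_def using K0 K3 by (simp_all add: add_nonneg_nonneg mult_nonneg_nonneg)
  have main: "\<exists>l\<in>insert 0 \<Lambda>. \<bar>\<rho> - l\<bar> \<le> K * (norm (loss_gradient M (M ** A, Y)))\<^sup>2"
    if zR: "norm (M ** A, Y) \<le> R" and b: "norm b = 1"
      and eig': "transpose (residual M (M ** A, Y)) *v (residual M (M ** A, Y) *v b) = \<rho> *\<^sub>R b"
    for A :: "real ^ 'r ^ 'n" and Y \<rho> b
  proof -
    define X where "X = M ** A"
    define E where "E = - residual M (X, Y)"
    define \<epsilon> where "\<epsilon> = norm (loss_gradient M (X, Y))"
    have e0: "\<epsilon> \<ge> 0" by (simp add: \<epsilon>_def)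
    have M: "M = X ** Y + E" by (simp add: E_def residual_def)
    have eig: "transpose E *v (E *v b) = \<rho> *\<^sub>R b"
      using eig' by (simp add: E_def X_def Gram_minus)
    have X: "norm X \<le> R" and Y: "norm Y \<le> R"
      using zR norm_fst_le[of X Y] norm_snd_le[of Y X] by (auto simp: X_def)
    have R: "R \<ge> 0" using X norm_ge_zero order_trans by blast
    have g1: "norm (E ** transpose Y) \<le> \<epsilon>"
    proof -
      have "2 * norm (E ** transpose Y) = norm (fst (loss_gradient M (X, Y)))"
        by (simp add: loss_gradient_def E_def matrix_mult.minus_left)
      also have "\<dots> \<le> \<epsilon>" unfolding \<epsilon>_def by (metis norm_fst_le prod.collapse)
      finally show ?thesis by (smt (verit) norm_ge_zero)
    qed
    have g2: "norm (transpose X ** E) \<le> \<epsilon>"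
    proof -
      have "2 * norm (transpose X ** E) = norm (snd (loss_gradient M (X, Y)))"
        by (simp add: loss_gradient_def E_def matrix_mult.minus_right)
      also have "\<dots> \<le> \<epsilon>" unfolding \<epsilon>_def by (metis norm_snd_le prod.collapse)
      finally show ?thesis by (smt (verit) norm_ge_zero)
    qed
    define s where "s = norm (E *v b)"
    have s0: "s \<ge> 0" by (simp add: s_def)
    have \<rho>: "\<rho> = s\<^sup>2"
    proof -
      have "inner (transpose E *v (E *v b)) b = \<rho>" using b by (simp add: eig dot_square_norm)
      then show ?thesis by (simp add: s_def inner_transpose_mult_vector power2_norm_eq_inner)
    qed
    have XEb: "norm (transpose X *v (E *v b)) \<le> \<epsilon>"
    proof -
      have "norm (transpose X *v (E *v b)) \<le> norm (transpose X ** E) * norm b"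
        unfolding matrix_vector_mul_assoc by (rule norm_matrix_vector_mult_le)
      then show ?thesis using g2 b by simp
    qed
    have YXE: "norm (transpose Y *v (transpose X *v (E *v b))) \<le> R * \<epsilon>"
      by (rule order_trans[OF norm_matrix_vector_mult_le mult_mono]) (use Y XEb R in auto)
    have MT: "transpose M *v w = transpose E *v w + transpose Y *v (transpose X *v w)" for w
      by (subst M) (simp add: transpose_add matrix_transpose_mul matrix_vector_mult_add_rdistrib matrix_vector_mul_assoc add.commute)
    have "\<exists>l\<in>insert 0 \<Lambda>. \<bar>\<rho> - l\<bar> \<le> K * \<epsilon>\<^sup>2"
    proof (cases "s \<le> \<sigma> / 2")
      case True
      have "E *v b = M *v (b - A *v (Y *v b))"
        by (simp add: E_def residual_def X_def matrix_vector_mult_diff_distrib matrix_vector_mult_diff_rdistrib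
            matrix_vector_mul_assoc matrix_mul_assoc)
      then have "\<sigma> * s \<le> norm (transpose M *v (E *v b))" using \<sigma>(2) by (simp add: s_def)
      also have "\<dots> \<le> norm (\<rho> *\<^sub>R b) + R * \<epsilon>"
        unfolding MT eig by (rule order_trans[OF norm_triangle_ineq add_left_mono[OF YXE]])
      also have "\<dots> = s * s + R * \<epsilon>" using b by (simp add: \<rho> power2_eq_square)
      also have "s * s \<le> (\<sigma> / 2) * s" using True s0 by (rule mult_right_mono)
      finally have "s \<le> 2 * R / \<sigma> * \<epsilon>" using \<sigma>(1) by (simp add: field_simps)
      then have "s\<^sup>2 \<le> (2 * R / \<sigma>)\<^sup>2 * \<epsilon>\<^sup>2" using s0 by (metis power_mono power_mult_distrib)
      also have "\<dots> \<le> K * \<epsilon>\<^sup>2" using K by (simp add: mult_right_mono)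
      finally show ?thesis using \<rho> by (intro bexI[of _ 0]) auto
    next
      case False
      have spos: "s > 0" using False \<sigma>(1) by linarith
      have Yb: "norm (Y *v b) \<le> (2 / \<sigma>) * \<epsilon>"
      proof -
        have "\<rho> *\<^sub>R (Y *v b) = transpose (E ** transpose Y) *v (E *v b)"
          by (simp add: matrix_transpose_mul eig flip: matrix_vector_mult_scaleR matrix_vector_mul_assoc)
        then have "s\<^sup>2 * norm (Y *v b) = norm (transpose (E ** transpose Y) *v (E *v b))"
          unfolding \<rho> by (metis abs_of_nonneg norm_scaleR zero_le_power2)
        also have "\<dots> \<le> \<epsilon> * s"
          by (rule order_trans[OF norm_matrix_vector_mult_le]) (simp add: s_def g1 mult_right_mono)
        finally have "s * norm (Y *v b) \<le> \<epsilon>" using spos by (simp add: power2_eq_square)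
        moreover have "(\<sigma> / 2) * norm (Y *v b) \<le> s * norm (Y *v b)"
          using False by (intro mult_right_mono) auto
        ultimately show ?thesis using \<sigma>(1) by (simp add: field_simps)
      qed
      have XYb: "norm (X *v (Y *v b)) \<le> R * ((2 / \<sigma>) * \<epsilon>)"
        by (rule order_trans[OF norm_matrix_vector_mult_le mult_mono]) (use X Yb R in auto)
      have Mb: "M *v b = E *v b + X *v (Y *v b)"
        by (subst M) (simp add: matrix_vector_mult_add_rdistrib matrix_vector_mul_assoc)
      have ETX: "norm (transpose E *v (X *v (Y *v b))) \<le> \<epsilon> * R"
      proof -
        have "transpose E *v (X *v (Y *v b)) = transpose (transpose X ** E) *v (Y *v b)"
          by (simp add: matrix_transpose_mul matrix_vector_mul_assoc matrix_mul_assoc)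
        also have "norm \<dots> \<le> norm (transpose X ** E) * (norm Y * norm b)"
          by (rule order_trans[OF norm_matrix_vector_mult_le]) (simp add: mult_left_mono norm_matrix_vector_mult_le)
        also have "\<dots> \<le> \<epsilon> * R" using g2 Y b R e0 by (intro mult_mono) auto
        finally show ?thesis .
      qed
      have YXXY: "norm (transpose Y *v (transpose X *v (X *v (Y *v b)))) \<le> R * (R * (R * ((2 / \<sigma>) * \<epsilon>)))"
      proof -
        have "norm (transpose X *v (X *v (Y *v b))) \<le> R * (R * ((2 / \<sigma>) * \<epsilon>))"
          by (rule order_trans[OF norm_matrix_vector_mult_le mult_mono]) (use X XYb R in auto)
        then show ?thesis
          by (rule order_trans[OF norm_matrix_vector_mult_le mult_mono[rotated]]) (use Y R in auto)
      qed
      have "T b - \<rho> *\<^sub>R b = transpose Y *v (transpose X *v (E *v b)) + transpose E *v (X *v (Y *v b))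
           + transpose Y *v (transpose X *v (X *v (Y *v b)))"
        by (simp add: T_def Mb MT matrix_vector_right_distrib eig)
      also have "norm \<dots> \<le> R * \<epsilon> + \<epsilon> * R + R * (R * (R * ((2 / \<sigma>) * \<epsilon>)))"
        by (intro norm_triangle_le add_mono YXE ETX YXXY)
      also have "\<dots> = K2 * \<epsilon>" by (simp add: K2_def algebra_simps)
      finally have res: "norm (T b - \<rho> *\<^sub>R b) \<le> K2 * \<epsilon>" .
      have "inner b (T b) = (norm (M *v b))\<^sup>2"
        by (metis T_def inner_commute inner_transpose_mult_vector power2_norm_eq_inner)
      also have "\<dots> = \<rho> + 2 * inner (E *v b) (X *v (Y *v b)) + (norm (X *v (Y *v b)))\<^sup>2"
        unfolding Mb using norm_diff_scaleR_square[of "E *v b" "-1" "X *v (Y *v b)"] by (simp add: \<rho> s_def)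
      also have "inner (E *v b) (X *v (Y *v b)) = inner (transpose X *v (E *v b)) (Y *v b)"
        by (simp add: inner_transpose_mult_vector)
      finally have eq: "inner b (T b) - \<rho> = 2 * inner (transpose X *v (E *v b)) (Y *v b) + (norm (X *v (Y *v b)))\<^sup>2"
        by simp
      have "\<bar>inner (transpose X *v (E *v b)) (Y *v b)\<bar> \<le> \<epsilon> * ((2 / \<sigma>) * \<epsilon>)"
        by (rule order_trans[OF Cauchy_Schwarz_ineq2 mult_mono]) (use XEb Yb e0 in auto)
      moreover have "(norm (X *v (Y *v b)))\<^sup>2 \<le> (R * ((2 / \<sigma>) * \<epsilon>))\<^sup>2"
        by (intro power_mono XYb) simp
      ultimately have "\<bar>inner b (T b) - \<rho>\<bar> \<le> 2 * (\<epsilon> * ((2 / \<sigma>) * \<epsilon>)) + (R * ((2 / \<sigma>) * \<epsilon>))\<^sup>2"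
        unfolding eq by (smt (verit) zero_le_power2)
      also have "\<dots> = K3 * \<epsilon>\<^sup>2" by (simp add: K3_def power2_eq_square algebra_simps)
      finally obtain l where l: "l \<in> \<Lambda>" "\<bar>\<rho> - l\<bar> \<le> K0 * ((K2 * \<epsilon>)\<^sup>2 + K3 * \<epsilon>\<^sup>2)"
        using near[OF b res] by blast
      have "K0 * ((K2 * \<epsilon>)\<^sup>2 + K3 * \<epsilon>\<^sup>2) = K0 * (K2\<^sup>2 + K3) * \<epsilon>\<^sup>2"
        by (simp add: power_mult_distrib algebra_simps)
      also have "\<dots> \<le> K * \<epsilon>\<^sup>2" using K(3) by (simp add: mult_right_mono)
      finally show ?thesis using l by (intro bexI[of _ l]) auto
    qed
    then show ?thesis by (simp add: \<epsilon>_def X_def)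
  qed
  show ?thesis using main \<Lambda> K(1) by (intro exI[of _ "insert 0 \<Lambda>"] exI[of _ K]) blast
qed

text \<open>The loss is the sum of the eigenvalues of \<open>E\<^sup>T E\<close>, so it is close to a sum of boundedly many members of a
  fixed finite set, and there are only finitely many such sums. Lists of bounded length
  serve as index sets because the eigenbasis varies with the point.\<close>

theorem loss_Lojasiewicz:
  fixes M :: "real ^ 'n ^ 'm" and R :: real
  shows "\<exists>C K. finite C \<and> K \<ge> 0 \<and>
    (\<forall>(A :: real ^ 'r ^ 'n) Y. norm (M ** A, Y) \<le> R \<longrightarrow>
       (\<exists>c\<in>C. \<bar>fact_loss M (M ** A, Y) - c\<bar> \<le> K * (norm (loss_gradient M (M ** A, Y)))\<^sup>2))"
proof -
  note [simp del] = transpose_matrix_vector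
  obtain \<Lambda> K where \<Lambda>: "finite \<Lambda>" and K: "K \<ge> 0" and near:
    "\<And>(A :: real ^ 'r ^ 'n) Y \<rho> b. norm (M ** A, Y) \<le> R \<Longrightarrow> norm b = 1 \<Longrightarrow>
       transpose (residual M (M ** A, Y)) *v (residual M (M ** A, Y) *v b) = \<rho> *\<^sub>R b \<Longrightarrow>
       \<exists>l\<in>\<Lambda>. \<bar>\<rho> - l\<bar> \<le> K * (norm (loss_gradient M (M ** A, Y)))\<^sup>2"
    using residual_eigenvalue_near_spectrum[where M = M and R = R and ?'r = 'r] by metis
  define C where "C = sum_list ` {xs. set xs \<subseteq> \<Lambda> \<and> length xs \<le> DIM(real ^ 'n)}"
  have "finite C" unfolding C_def using \<Lambda> by (intro finite_imageI finite_lists_length_le)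
  moreover have "\<exists>c\<in>C. \<bar>fact_loss M (M ** A, Y) - c\<bar> \<le> real DIM(real ^ 'n) * K * (norm (loss_gradient M (M ** A, Y)))\<^sup>2"
    if zR: "norm (M ** A, Y) \<le> R" for A :: "real ^ 'r ^ 'n" and Y
  proof -
    let ?E = "residual M (M ** A, Y)" and ?d = "K * (norm (loss_gradient M (M ** A, Y)))\<^sup>2"
    define T where "T x = transpose ?E *v (?E *v x)" for x
    have linT: "linear T" and saT: "\<And>x y. inner (T x) y = inner x (T y)"
      unfolding T_def by (rule linear_Gram, rule Gram_selfadjoint)
    obtain B l where B: "pairwise orthogonal B" "\<And>b. b \<in> B \<Longrightarrow> norm b = 1" "span B = UNIV" "finite B"
      and eig: "\<And>b. b \<in> B \<Longrightarrow> T b = l b *\<^sub>R b"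
      using selfadjoint_orthonormal_eigenbasis[OF linT saT] by blast
    have "\<forall>b\<in>B. \<exists>c\<in>\<Lambda>. \<bar>l b - c\<bar> \<le> ?d"
      using near[OF zR] B(2) eig unfolding T_def by blast
    then obtain c where c: "\<And>b. b \<in> B \<Longrightarrow> c b \<in> \<Lambda> \<and> \<bar>l b - c b\<bar> \<le> ?d" by metis
    have "(norm (?E *v b))\<^sup>2 = l b" if "b \<in> B" for b
    proof -
      have "(norm (?E *v b))\<^sup>2 = inner (T b) b" by (simp add: T_def inner_transpose_mult_vector power2_norm_eq_inner)
      then show ?thesis using B(2)[OF that] by (simp add: eig[OF that] dot_square_norm)
    qed
    moreover have "(norm ?E)\<^sup>2 = (\<Sum>b\<in>B. (norm (?E *v b))\<^sup>2)"
      by (rule norm_matrix_orthonormal) (use B in auto)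
    ultimately have "fact_loss M (M ** A, Y) = (\<Sum>b\<in>B. l b)"
      by (simp add: fact_loss_eq)
    then have "\<bar>fact_loss M (M ** A, Y) - (\<Sum>b\<in>B. c b)\<bar> = \<bar>\<Sum>b\<in>B. l b - c b\<bar>"
      by (simp add: sum_subtractf)
    also have "\<dots> \<le> (\<Sum>b\<in>B. ?d)" by (rule order_trans[OF sum_abs sum_mono]) (use c in blast)
    also have "\<dots> = card B * ?d" by simp
    finally have close: "\<bar>fact_loss M (M ** A, Y) - (\<Sum>b\<in>B. c b)\<bar> \<le> card B * ?d" .
    have "independent B" using B by (metis norm_zero pairwise_orthogonal_independent zero_neq_one)
    then have cardB: "card B \<le> DIM(real ^ 'n)" using independent_bound by blast
    obtain bs where bs: "set bs = B" "distinct bs" using B(4) finite_distinct_list by blast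
    have "(\<Sum>b\<in>B. c b) = sum_list (map c bs)" using bs by (metis sum_list_distinct_conv_sum_set)
    moreover have "length (map c bs) \<le> DIM(real ^ 'n)" using bs cardB by (metis distinct_card length_map)
    moreover have "set (map c bs) \<subseteq> \<Lambda>" using c bs by auto
    ultimately have inC: "(\<Sum>b\<in>B. c b) \<in> C" unfolding C_def by blast
    have "card B * ?d \<le> real DIM(real ^ 'n) * ?d"
      using cardB K by (intro mult_right_mono) auto
    then show ?thesis using close inC by (intro bexI[OF _ inC]) (simp add: mult.assoc)
  qed
  ultimately show ?thesis using K by (intro exI[of _ C] exI[of _ "real DIM(real ^ 'n) * K"]) auto
qed

section \<open>Linear convergence through finitely many critical levels\<close>

text \<open>The values decrease to a limit \<open>w\<close> and the steps tend to zero, so the nearby level is eventually \<open>w\<close>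
  itself, by finiteness. From then on \<open>v k - w\<close> is at most a multiple of the squared step length,
  hence of the decrease \<open>v k - v (k + 1)\<close>; this makes \<open>v k - w\<close> geometrically small. The step length is at most a multiple
  of its square root, so the steps are geometrically summable.\<close>

theorem descent_finite_levels_converges_linearly:
  fixes z :: "nat \<Rightarrow> 'a::banach" and v :: "nat \<Rightarrow> real"
  assumes a: "a > 0" and K: "K > 0" and vpos: "\<And>k. v k \<ge> 0"
    and desc: "\<And>k. a * (norm (z (Suc k) - z k))\<^sup>2 \<le> v k - v (Suc k)"
    and C: "finite C" and near: "\<And>k. \<exists>c\<in>C. \<bar>v k - c\<bar> \<le> K * (norm (z (Suc k) - z k))\<^sup>2"
  shows "\<exists>l. converges_linearly_to z l \<and> z \<longlonglongrightarrow> l"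
proof -
  define s where "s k = norm (z (Suc k) - z k)" for k
  have s0: "s k \<ge> 0" for k by (simp add: s_def)
  have mono: "v (Suc k) \<le> v k" for k
    using desc[of k] a by (smt (verit) mult_nonneg_nonneg zero_le_power2)
  have dec: "decseq v" by (rule decseq_SucI) (rule mono)
  obtain w where lim: "v \<longlonglongrightarrow> w" and vw: "\<And>k. w \<le> v k"
    using decseq_convergent[OF dec, of 0] vpos by blast
  have "(\<lambda>k. (v k - v (Suc k)) / a) \<longlonglongrightarrow> (w - w) / a"
    by (intro tendsto_intros lim LIMSEQ_Suc) (use a in auto)
  then have d0: "(\<lambda>k. (v k - v (Suc k)) / a) \<longlonglongrightarrow> 0" by simp
  have "s k ^ 2 \<le> (v k - v (Suc k)) / a" for k
    using desc[of k] a by (simp add: s_def field_simps)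
  then have s2: "(\<lambda>k. s k ^ 2) \<longlonglongrightarrow> 0"
    by (intro tendsto_sandwich[OF _ _ tendsto_const d0]) auto
  obtain c where c: "\<And>k. c k \<in> C \<and> \<bar>v k - c k\<bar> \<le> K * s k ^ 2"
    using near unfolding s_def by metis
  have "\<exists>e>0. \<forall>x\<in>C. x \<noteq> w \<longrightarrow> e \<le> dist x w"
    using finite_set_avoid[OF C, of w] by (metis dist_commute)
  then obtain e where e: "e > 0" "\<And>x. x \<in> C \<Longrightarrow> x \<noteq> w \<Longrightarrow> e \<le> dist x w" by blast
  have "(\<lambda>k. K * s k ^ 2 + (v k - w)) \<longlonglongrightarrow> K * 0 + (w - w)"
    by (intro tendsto_intros s2 lim)
  then have "\<forall>\<^sub>F k in sequentially. K * s k ^ 2 + (v k - w) < e"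
    using e(1) by (intro order_tendstoD) auto
  then obtain N where N: "\<And>k. k \<ge> N \<Longrightarrow> K * s k ^ 2 + (v k - w) < e"
    by (auto simp: eventually_sequentially)
  have cw: "c k = w" if "k \<ge> N" for k
  proof (rule ccontr)
    assume "c k \<noteq> w"
    then have "e \<le> \<bar>c k - w\<bar>" using e(2) c by (simp add: dist_real_def)
    moreover have "\<bar>c k - w\<bar> \<le> \<bar>v k - c k\<bar> + (v k - w)" using vw[of k] by linarith
    ultimately show False using N[OF that] c[of k] by linarith
  qed
  define p where "p k = v k - w" for k
  have p0: "p k \<ge> 0" for k using vw by (simp add: p_def)
  have PL: "p k \<le> K * s k ^ 2" if "k \<ge> N" for k
    using c[of k] cw[OF that] unfolding p_def by linarith
  \<comment> \<open>the maximum with \<open>1/2\<close> keeps the contraction factor positive when \<open>a \<ge> K\<close>\<close>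
  define r where "r = max (1/2) (1 - a / K)"
  have r: "0 < r" "r < 1" using a K by (auto simp: r_def)
  have contr: "p (Suc k) \<le> r * p k" if "k \<ge> N" for k
  proof -
    have "a / K * p k \<le> a * s k ^ 2" using PL[OF that] a K by (simp add: field_simps)
    also have "\<dots> \<le> p k - p (Suc k)" using desc[of k] by (simp add: s_def p_def)
    finally have "p (Suc k) \<le> (1 - a / K) * p k" by (simp add: algebra_simps)
    also have "\<dots> \<le> r * p k" by (intro mult_right_mono p0) (simp add: r_def)
    finally show ?thesis .
  qed
  have geo: "p (N + k) \<le> p N * r ^ k" for k
  proof (induction k)
    case (Suc k)
    have "p (N + Suc k) \<le> r * p (N + k)" using contr[of "N + k"] by simp
    also have "\<dots> \<le> r * (p N * r ^ k)" using Suc r by (intro mult_left_mono) auto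
    finally show ?case by (simp add: algebra_simps)
  qed simp
  define q where "q = sqrt r"
  have q: "0 < q" "q < 1" using r by (auto simp: q_def)
  define D where "D = sqrt (p N / a)"
  have D0: "D \<ge> 0" using p0 a by (simp add: D_def)
  have sgeo: "s (N + k) \<le> D * q ^ k" for k
  proof (rule power2_le_imp_le)
    have "a * s (N + k) ^ 2 \<le> p (N + k)"
      using desc[of "N + k"] p0[of "Suc (N + k)"] by (simp add: s_def p_def)
    also have "\<dots> \<le> p N * r ^ k" by (rule geo)
    finally have "s (N + k) ^ 2 \<le> p N / a * r ^ k" using a by (simp add: field_simps)
    also have "\<dots> = (D * q ^ k)\<^sup>2"
    proof -
      have "(q ^ k)\<^sup>2 = (q\<^sup>2) ^ k" by (simp add: mult.commute flip: power_mult)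
      then show ?thesis using p0[of N] a r by (simp add: D_def q_def power_mult_distrib)
    qed
    finally show "s (N + k) ^ 2 \<le> (D * q ^ k)\<^sup>2" .
    show "0 \<le> D * q ^ k" using D0 q by simp
  qed
  have part: "norm (z (N + (k + j)) - z (N + k)) \<le> D / (1 - q) * q ^ k * (1 - q ^ j)" for k j
  proof (induction j)
    case (Suc j)
    have "norm (z (N + (k + Suc j)) - z (N + k))
        \<le> norm (z (N + (k + j)) - z (N + k)) + s (N + (k + j))"
      unfolding s_def using norm_triangle_ineq[of "z (N + (k + j)) - z (N + k)" "z (Suc (N + (k + j))) - z (N + (k + j))"] by simp
    also have "\<dots> \<le> D / (1 - q) * q ^ k * (1 - q ^ j) + D * q ^ (k + j)"
      using Suc sgeo[of "k + j"] by simp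
    also have "\<dots> = D / (1 - q) * q ^ k * (1 - q ^ Suc j)"
      using q by (simp add: field_simps power_add)
    finally show ?case .
  qed simp
  have tail: "norm (z (N + (k + j)) - z (N + k)) \<le> D / (1 - q) * q ^ k" for k j
  proof -
    have "D / (1 - q) * q ^ k * (1 - q ^ j) \<le> D / (1 - q) * q ^ k * 1"
      using q D0 by (intro mult_left_mono) auto
    then show ?thesis using part[of k j] by linarith
  qed
  have "Cauchy (\<lambda>k. z (N + k))"
  proof (rule metric_CauchyI)
    fix \<epsilon> :: real assume "\<epsilon> > 0"
    have "(\<lambda>k. D / (1 - q) * q ^ k) \<longlonglongrightarrow> D / (1 - q) * 0"
      using q by (intro tendsto_intros LIMSEQ_power_zero) auto
    then have "\<forall>\<^sub>F k in sequentially. D / (1 - q) * q ^ k < \<epsilon> / 2"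
      using \<open>\<epsilon> > 0\<close> by (intro order_tendstoD) auto
    then obtain k0 where k0: "D / (1 - q) * q ^ k0 < \<epsilon> / 2"
      by (auto simp: eventually_sequentially)
    have "dist (z (N + m)) (z (N + k0)) < \<epsilon> / 2" if "m \<ge> k0" for m
    proof -
      have "dist (z (N + m)) (z (N + k0)) \<le> D / (1 - q) * q ^ k0"
        using tail[of k0 "m - k0"] that by (simp only: dist_norm le_add_diff_inverse)
      then show ?thesis using k0 by linarith
    qed
    then show "\<exists>M. \<forall>m\<ge>M. \<forall>n\<ge>M. dist (z (N + m)) (z (N + n)) < \<epsilon>"
      by (metis dist_triangle_half_l)
  qed
  then obtain l where l: "(\<lambda>k. z (N + k)) \<longlonglongrightarrow> l" unfolding Cauchy_convergent_iff convergent_def by blast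
  then have zl: "z \<longlonglongrightarrow> l" by (simp add: LIMSEQ_offset[of z N] add.commute)
  have close: "norm (z (N + k) - l) \<le> D / (1 - q) * q ^ k" for k
  proof -
    have "(\<lambda>j. z (N + (k + j))) \<longlonglongrightarrow> l"
      using LIMSEQ_ignore_initial_segment[OF l, of k] by (simp add: add.commute)
    then have "(\<lambda>j. norm (z (N + (k + j)) - z (N + k))) \<longlonglongrightarrow> norm (l - z (N + k))"
      by (intro tendsto_intros)
    then have "norm (l - z (N + k)) \<le> D / (1 - q) * q ^ k"
      by (rule LIMSEQ_le_const2) (use tail in auto)
    then show ?thesis by (simp add: norm_minus_commute)
  qed
  \<comment> \<open>enlarged so that the bound also covers the finitely many iterates before \<open>N\<close>\<close>
  define G where "G = D / (1 - q) / q ^ N + (\<Sum>k<N. norm (z k - l) / q ^ k) + 1"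
  have nn: "0 \<le> D / (1 - q) / q ^ N" "0 \<le> (\<Sum>k<N. norm (z k - l) / q ^ k)"
    using q D0 by (auto intro!: sum_nonneg)
  have "G > 0" unfolding G_def using nn by linarith
  moreover have "norm (z k - l) \<le> G * q ^ k" for k
  proof (cases "k < N")
    case True
    have "norm (z k - l) / q ^ k \<le> (\<Sum>k<N. norm (z k - l) / q ^ k)"
      using True q by (intro member_le_sum) auto
    also have "\<dots> \<le> G" unfolding G_def using nn by linarith
    finally show ?thesis using q by (simp add: field_simps)
  next
    case False
    have "norm (z k - l) \<le> D / (1 - q) * q ^ (k - N)" using close[of "k - N"] False by simp
    also have "\<dots> = D / (1 - q) / q ^ N * q ^ k" using q False by (simp add: power_diff)
    also have "\<dots> \<le> G * q ^ k" using q nn by (intro mult_right_mono) (auto simp: G_def)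
    finally show ?thesis .
  qed
  ultimately have "converges_linearly_to z l"
    unfolding converges_linearly_to_def using q by (intro exI[of _ G] conjI bexI[of _ q] allI) auto
  then show ?thesis using zl by blast
qed

section \<open>Orbits that converge to strict saddles\<close>

text \<open>A bound on the operator norm that is visibly continuous in the operator when continuity is known only
  pointwise.\<close>

lemma linear_norm_le_sum_Basis:
  fixes f :: "'a::euclidean_space \<Rightarrow> 'b::real_normed_vector"
  assumes "linear f"
  shows "norm (f x) \<le> (\<Sum>b\<in>Basis. norm (f b)) * norm x"
proof -
  have "f x = f (\<Sum>b\<in>Basis. inner x b *\<^sub>R b)" by (simp only: euclidean_representation)
  also have "\<dots> = (\<Sum>b\<in>Basis. inner x b *\<^sub>R f b)"
    by (simp add: linear_sum[OF assms] linear_scale[OF assms])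
  also have "norm \<dots> \<le> (\<Sum>b\<in>Basis. norm (f b) * norm x)"
  proof (rule sum_norm_le)
    fix b :: 'a assume "b \<in> Basis"
    then have "\<bar>inner x b\<bar> \<le> norm x" by (rule Basis_le_norm)
    then show "norm (inner x b *\<^sub>R f b) \<le> norm (f b) * norm x"
      by (simp add: mult.commute[of "norm (f b)"] mult_right_mono)
  qed
  finally show ?thesis by (simp add: sum_distrib_right)
qed

lemma C1_derivative_bounded:
  fixes F' :: "'a::euclidean_space \<Rightarrow> 'a \<Rightarrow> 'b::real_normed_vector"
  assumes lin: "\<And>x. linear (F' x)" and cont: "\<And>d. continuous_on UNIV (\<lambda>x. F' x d)"
  obtains L where "L > 0" "\<And>x d. norm x \<le> R \<Longrightarrow> norm (F' x d) \<le> L * norm d"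
proof -
  let ?s = "\<lambda>x. \<Sum>b\<in>Basis. norm (F' x b)"
  have "continuous_on (cball 0 R) ?s"
    by (intro continuous_intros continuous_on_subset[OF cont]) auto
  then have "compact (?s ` cball 0 R)" by (intro compact_continuous_image) auto
  then have "bounded (?s ` cball 0 R)" by (rule compact_imp_bounded)
  then obtain L where "\<forall>y\<in>?s ` cball 0 R. norm y \<le> L" unfolding bounded_iff by blast
  then have L: "\<And>x. x \<in> cball 0 R \<Longrightarrow> \<bar>?s x\<bar> \<le> L" by simp
  show ?thesis
  proof
    show "\<bar>L\<bar> + 1 > 0" by simp
    show "norm (F' x d) \<le> (\<bar>L\<bar> + 1) * norm d" if "norm x \<le> R" for x d
    proof -
      have "?s x \<le> \<bar>L\<bar> + 1" using L[of x] that by simp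
      then show ?thesis
        by (intro order_trans[OF linear_norm_le_sum_Basis[OF lin] mult_right_mono]) auto
    qed
  qed
qed

text \<open>The mean value inequality for \<open>F - F' p\<close>, whose derivative is small near \<open>p\<close>.\<close>

lemma C1_strictly_differentiable:
  fixes F :: "'a::euclidean_space \<Rightarrow> 'b::real_normed_vector"
  assumes der: "\<And>x. (F has_derivative F' x) (at x)" and cont: "\<And>d. continuous_on UNIV (\<lambda>x. F' x d)"
    and \<eta>: "\<eta> > 0"
  obtains \<epsilon> where "\<epsilon> > 0"
    "\<And>x y. x \<in> cball p \<epsilon> \<Longrightarrow> y \<in> cball p \<epsilon> \<Longrightarrow> norm (F x - F y - F' p (x - y)) \<le> \<eta> * norm (x - y)"
proof -
  have lin: "linear (F' x)" for x using der by (rule has_derivative_linear)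
  let ?s = "\<lambda>x. \<Sum>b\<in>Basis. norm (F' x b - F' p b)"
  have "continuous_on UNIV ?s" by (intro continuous_intros cont)
  then have "(?s \<longlongrightarrow> ?s p) (at p)" unfolding continuous_on_def by blast
  then have "(?s \<longlongrightarrow> 0) (at p)" by simp
  then have "\<forall>\<^sub>F x in at p. ?s x < \<eta>" by (rule order_tendstoD) (simp add: \<eta>)
  then obtain d where d: "d > 0" "\<And>x. x \<noteq> p \<Longrightarrow> dist x p < d \<Longrightarrow> ?s x < \<eta>"
    by (auto simp: eventually_at)
  have s: "?s x \<le> \<eta>" if "x \<in> cball p (d/2)" for x
    using d(1) d(2)[of x] that \<eta> by (cases "x = p") (auto simp: dist_commute less_imp_le)
  show ?thesis
  proof (rule that[of "d/2"])
    show "norm (F x - F y - F' p (x - y)) \<le> \<eta> * norm (x - y)"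
      if "x \<in> cball p (d/2)" "y \<in> cball p (d/2)" for x y
    proof -
      have "norm ((F x - F' p x) - (F y - F' p y)) \<le> \<eta> * norm (x - y)"
      proof (rule differentiable_bound[OF convex_cball _ _ that])
        fix w assume w: "w \<in> cball p (d/2)"
        show "((\<lambda>x. F x - F' p x) has_derivative (\<lambda>h. F' w h - F' p h)) (at w within cball p (d/2))"
          by (intro has_derivative_diff has_derivative_at_withinI[OF der]
                linear_imp_has_derivative lin)
        show "onorm (\<lambda>h. F' w h - F' p h) \<le> \<eta>"
        proof (rule onorm_le)
          fix h
          have "norm (F' w h - F' p h) \<le> ?s w * norm h"
            by (rule linear_norm_le_sum_Basis[of "\<lambda>h. F' w h - F' p h"]) (intro linear_compose_sub lin)
          also have "\<dots> \<le> \<eta> * norm h" by (intro mult_right_mono s w) simp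
          finally show "norm (F' w h - F' p h) \<le> \<eta> * norm h" .
        qed
      qed
      then show ?thesis by (simp add: linear_diff[OF lin] algebra_simps)
    qed
  qed (use d in auto)
qed

text \<open>Take \<open>Q d = \<parallel>L d\<parallel>\<^sup>2 - \<mu> \<parallel>d\<parallel>\<^sup>2\<close>. Self-adjointness gives \<open>Q (L d) - \<mu> Q d = \<parallel>(L\<^sup>2 - \<mu>) d\<parallel>\<^sup>2\<close>, which is
  at least a positive multiple of \<open>\<parallel>d\<parallel>\<^sup>2\<close> if \<open>\<mu>\<close> is not an eigenvalue of \<open>L\<^sup>2\<close>; this margin absorbs the
  perturbation \<open>e\<close>. The finitely many eigenvalues leave a suitable \<open>\<mu>\<close> between \<open>1\<close> and
  \<open>(\<parallel>L v\<parallel> / \<parallel>v\<parallel>)\<^sup>2\<close>, and then \<open>Q v > 0\<close>. The form replaces an invariant cone field, without a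
  splitting into stable and unstable spaces.\<close>

lemma expanding_quadratic_form:
  fixes L :: "'a::euclidean_space \<Rightarrow> 'a"
  assumes lin: "linear L" and sa: "\<And>x y. inner (L x) y = inner x (L y)"
    and v: "norm (L v) > norm v"
  obtains Q \<mu> \<eta> K where "\<mu> > 1" "\<eta> > 0" "\<And>t::real. t \<noteq> 0 \<Longrightarrow> Q (t *\<^sub>R v) > 0"
    "\<And>d. Q d \<le> K * (norm d)\<^sup>2"
    "\<And>d e. norm e \<le> \<eta> * norm d \<Longrightarrow> Q (L d + e) \<ge> \<mu> * Q d"
proof -
  obtain B l where B: "pairwise orthogonal B" "\<And>b. b \<in> B \<Longrightarrow> norm b = 1" "span B = UNIV" "finite B"
    and eig: "\<And>b. b \<in> B \<Longrightarrow> L b = l b *\<^sub>R b"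
    using selfadjoint_orthonormal_eigenbasis[OF lin sa] by blast
  have v0: "v \<noteq> 0" using v linear_0[OF lin] by auto
  define q where "q = (norm (L v) / norm v)\<^sup>2"
  have "norm (L v) / norm v > 1" using v v0 by simp
  then have "q > 1" unfolding q_def by (simp add: one_less_power)
  then have "infinite {1<..<q}" by (simp add: infinite_Ioo)
  then have "\<not> {1<..<q} \<subseteq> (\<lambda>b. (l b)\<^sup>2) ` B" using B(4) finite_surj by blast
  then obtain \<mu> where "\<mu> \<in> {1<..<q}" and \<mu>n: "\<mu> \<notin> (\<lambda>b. (l b)\<^sup>2) ` B" by blast
  then have \<mu>: "1 < \<mu>" "\<mu> < q" "\<mu> \<notin> (\<lambda>b. (l b)\<^sup>2) ` B" by simp_all
  \<comment> \<open>the distance of \<open>\<mu>\<close> from the spectrum of \<open>L\<^sup>2\<close>, squared\<close>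
  define c where "c = Min (insert 1 ((\<lambda>b. ((l b)\<^sup>2 - \<mu>)\<^sup>2) ` B))"
  have c0: "c > 0" unfolding c_def using B(4) \<mu>(3) by (subst Min_gr_iff) auto
  have cle: "c \<le> ((l b)\<^sup>2 - \<mu>)\<^sup>2" if "b \<in> B" for b
    unfolding c_def by (rule Min_le) (use B(4) that in auto)
  have pars: "inner x y = (\<Sum>b\<in>B. inner x b * inner y b)" for x y
    by (rule orthonormal_Parseval) (use B in auto)
  have gap: "c * (norm d)\<^sup>2 \<le> (norm (L (L d) - \<mu> *\<^sub>R d))\<^sup>2" for d
  proof -
    have "inner (L (L d)) b = (l b)\<^sup>2 * inner d b" if "b \<in> B" for b
      using that by (simp add: sa eig linear_scale[OF lin] power2_eq_square)
    then have co: "inner (L (L d) - \<mu> *\<^sub>R d) b = ((l b)\<^sup>2 - \<mu>) * inner d b" if "b \<in> B" for b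
      using that by (simp add: inner_diff_left algebra_simps)
    have "c * (norm d)\<^sup>2 = (\<Sum>b\<in>B. c * (inner d b)\<^sup>2)"
      unfolding power2_norm_eq_inner pars[of d d] by (simp add: sum_distrib_left power2_eq_square)
    also have "\<dots> \<le> (\<Sum>b\<in>B. ((l b)\<^sup>2 - \<mu>)\<^sup>2 * (inner d b)\<^sup>2)"
      by (intro sum_mono mult_right_mono cle) auto
    also have "\<dots> = (\<Sum>b\<in>B. inner (L (L d) - \<mu> *\<^sub>R d) b * inner (L (L d) - \<mu> *\<^sub>R d) b)"
    proof (intro sum.cong refl)
      fix b assume "b \<in> B"
      show "((l b)\<^sup>2 - \<mu>)\<^sup>2 * (inner d b)\<^sup>2
          = inner (L (L d) - \<mu> *\<^sub>R d) b * inner (L (L d) - \<mu> *\<^sub>R d) b"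
        unfolding co[OF \<open>b \<in> B\<close>] by (simp add: power2_eq_square)
    qed
    also have "\<dots> = (norm (L (L d) - \<mu> *\<^sub>R d))\<^sup>2"
      unfolding power2_norm_eq_inner by (rule pars[symmetric])
    finally show ?thesis .
  qed
  define Q where "Q d = (norm (L d))\<^sup>2 - \<mu> * (norm d)\<^sup>2" for d
  obtain K where K: "K > 0" "\<And>x. norm (L x) \<le> K * norm x"
    using linear_bounded_pos[OF lin] by (metis mult.commute)
  define D where "D = 2 * K ^ 3 + 2 * \<mu> * K + \<mu>"
  have D0: "D > 0" unfolding D_def using K \<mu> by (simp add: add_pos_pos)
  define \<eta> where "\<eta> = min 1 (c / D)"
  have \<eta>: "\<eta> > 0" "\<eta> \<le> 1" "D * \<eta> \<le> c" using c0 D0 by (auto simp: \<eta>_def min_def field_simps)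
  show ?thesis
  proof (rule that[of \<mu> \<eta> Q "K\<^sup>2"])
    show "Q (t *\<^sub>R v) > 0" if "t \<noteq> 0" for t
    proof -
      have "\<mu> * (norm v)\<^sup>2 < (norm (L v))\<^sup>2"
        using \<mu>(2) v0 unfolding q_def by (simp add: power_divide field_simps)
      then have "t\<^sup>2 * (\<mu> * (norm v)\<^sup>2) < t\<^sup>2 * (norm (L v))\<^sup>2" using that by simp
      then show ?thesis by (simp add: Q_def linear_scale[OF lin] power_mult_distrib algebra_simps)
    qed
    show "Q d \<le> K\<^sup>2 * (norm d)\<^sup>2" for d
    proof -
      have "(norm (L d))\<^sup>2 \<le> (K * norm d)\<^sup>2" by (intro power_mono K) simp
      moreover have "0 \<le> \<mu> * (norm d)\<^sup>2" using \<mu>(1) by simp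
      ultimately show ?thesis by (simp add: Q_def power_mult_distrib)
    qed
    show "\<mu> * Q d \<le> Q (L d + e)" if e: "norm e \<le> \<eta> * norm d" for d e
    proof -
      have sq: "(norm (a + b))\<^sup>2 = (norm a)\<^sup>2 + 2 * inner a b + (norm b)\<^sup>2" for a b :: 'a
        using norm_diff_scaleR_square[of a "-1" b] by simp
      have LLd: "inner (L (L d)) d = (norm (L d))\<^sup>2" by (simp add: sa power2_norm_eq_inner)
      have 1: "Q (L d) = \<mu> * Q d + (norm (L (L d) - \<mu> *\<^sub>R d))\<^sup>2"
        unfolding Q_def norm_diff_scaleR_square LLd by (simp add: power2_eq_square algebra_simps)
      have 2: "Q (L d + e) = Q (L d) + 2 * inner (L (L d)) (L e) + (norm (L e))\<^sup>2
          - 2 * \<mu> * inner (L d) e - \<mu> * (norm e)\<^sup>2"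
        unfolding Q_def linear_add[OF lin] sq by (simp add: algebra_simps)
      have ne: "norm e \<le> norm d" using e \<eta>(2) by (metis mult_left_le_one_le norm_ge_zero order_trans \<eta>(1) less_imp_le)
      have Ld: "norm (L d) \<le> K * norm d" by (rule K)
      have i1: "\<bar>inner (L (L d)) (L e)\<bar> \<le> (K * (K * norm d)) * (K * norm e)"
      proof (rule order_trans[OF Cauchy_Schwarz_ineq2 mult_mono])
        show "norm (L (L d)) \<le> K * (K * norm d)"
          using K(2)[of "L d"] mult_left_mono[OF Ld, of K] K(1) by linarith
      qed (use K in auto)
      have i2: "\<bar>inner (L d) e\<bar> \<le> (K * norm d) * norm e"
        by (rule order_trans[OF Cauchy_Schwarz_ineq2 mult_right_mono]) (use K in auto)
      have i3: "(norm e)\<^sup>2 \<le> norm d * norm e"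
        unfolding power2_eq_square using ne by (intro mult_right_mono) auto
      have j1: "- 2 * inner (L (L d)) (L e) \<le> 2 * K ^ 3 * (norm d * norm e)"
      proof -
        have "- 2 * inner (L (L d)) (L e) \<le> 2 * ((K * (K * norm d)) * (K * norm e))" using i1 by linarith
        also have "\<dots> = 2 * K ^ 3 * (norm d * norm e)" by (simp add: power3_eq_cube)
        finally show ?thesis .
      qed
      have j2: "2 * \<mu> * inner (L d) e \<le> 2 * \<mu> * K * (norm d * norm e)"
      proof -
        have "2 * \<mu> * inner (L d) e \<le> 2 * \<mu> * ((K * norm d) * norm e)"
          using i2 \<mu>(1) by (intro mult_left_mono) auto
        then show ?thesis by (simp add: algebra_simps)
      qed
      have j3: "\<mu> * (norm e)\<^sup>2 \<le> \<mu> * (norm d * norm e)" using i3 \<mu>(1) by (intro mult_left_mono) auto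
      have "- 2 * inner (L (L d)) (L e) + 2 * \<mu> * inner (L d) e + \<mu> * (norm e)\<^sup>2 \<le> D * (norm d * norm e)"
      proof -
        have "D * (norm d * norm e) = 2 * K ^ 3 * (norm d * norm e) + 2 * \<mu> * K * (norm d * norm e) + \<mu> * (norm d * norm e)"
          unfolding D_def by (simp only: distrib_right)
        then show ?thesis using j1 j2 j3 by linarith
      qed
      also have "\<dots> \<le> D * (norm d * (\<eta> * norm d))"
        using D0 e by (intro mult_left_mono) auto
      also have "\<dots> = (D * \<eta>) * (norm d)\<^sup>2" by (simp add: power2_eq_square)
      also have "\<dots> \<le> c * (norm d)\<^sup>2" using \<eta>(3) by (intro mult_right_mono) auto
      also have "\<dots> \<le> (norm (L (L d) - \<mu> *\<^sub>R d))\<^sup>2" by (rule gap)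
      finally show ?thesis using 1 2 zero_le_power2[of "norm (L e)"] by linarith
    qed
  qed (use \<mu> \<eta> in auto)
qed

text \<open>The difference of two orbits that stay close to \<open>p\<close> evolves by \<open>g' p\<close> up to a small relative error. If
  it starts as a nonzero multiple of \<open>v\<close>, the quadratic form is positive and grows
  exponentially along it, which contradicts boundedness.\<close>

lemma orbits_near_strict_saddle:
  fixes g :: "'a::euclidean_space \<Rightarrow> 'a"
  assumes der: "\<And>x. (g has_derivative g' x) (at x)" and cont: "\<And>d. continuous_on UNIV (\<lambda>x. g' x d)"
    and sa: "\<And>x y. inner (g' p x) y = inner x (g' p y)" and v: "norm (g' p v) > norm v"
  obtains \<epsilon> where "\<epsilon> > 0"
    "\<And>x t. \<lbrakk>\<forall>k. (g ^^ k) x \<in> cball p \<epsilon>; \<forall>k. (g ^^ k) (x + t *\<^sub>R v) \<in> cball p \<epsilon>\<rbrakk> \<Longrightarrow> t = 0"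
proof -
  have lin: "linear (g' p)" using der by (rule has_derivative_linear)
  obtain Q \<mu> \<eta> K where \<mu>: "\<mu> > 1" and \<eta>: "\<eta> > 0" and Qv: "\<And>t::real. t \<noteq> 0 \<Longrightarrow> Q (t *\<^sub>R v) > 0"
    and QK: "\<And>d. Q d \<le> K * (norm d)\<^sup>2"
    and Q: "\<And>d e. norm e \<le> \<eta> * norm d \<Longrightarrow> Q (g' p d + e) \<ge> \<mu> * Q d"
    using expanding_quadratic_form[OF lin sa v] by metis
  obtain \<epsilon> where \<epsilon>: "\<epsilon> > 0" and strict:
    "\<And>x y. x \<in> cball p \<epsilon> \<Longrightarrow> y \<in> cball p \<epsilon> \<Longrightarrow> norm (g x - g y - g' p (x - y)) \<le> \<eta> * norm (x - y)"
    using C1_strictly_differentiable[OF der cont \<eta>, of p] by metis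
  show ?thesis
  proof (rule that[OF \<epsilon>], rule ccontr)
    fix x and t :: real
    assume x: "\<forall>k. (g ^^ k) x \<in> cball p \<epsilon>" and y: "\<forall>k. (g ^^ k) (x + t *\<^sub>R v) \<in> cball p \<epsilon>" and t: "t \<noteq> 0"
    define d where "d k = (g ^^ k) (x + t *\<^sub>R v) - (g ^^ k) x" for k
    have step: "\<mu> * Q (d k) \<le> Q (d (Suc k))" for k
    proof -
      have "norm (d (Suc k) - g' p (d k)) \<le> \<eta> * norm (d k)"
        unfolding d_def using strict x y by simp
      from Q[OF this] show ?thesis by simp
    qed
    have grow: "\<mu> ^ k * Q (d 0) \<le> Q (d k)" for k
    proof (induction k)
      case (Suc k)
      have "\<mu> * (\<mu> ^ k * Q (d 0)) \<le> \<mu> * Q (d k)" using Suc \<mu> by (intro mult_left_mono) auto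
      then show ?case using step[of k] by (simp add: mult.assoc)
    qed simp
    have Q0: "Q (d 0) > 0" using Qv[OF t] by (simp add: d_def)
    have up: "\<mu> ^ k * Q (d 0) \<le> \<bar>K\<bar> * (2 * \<epsilon>)\<^sup>2" for k
    proof -
      have "norm (d k) \<le> 2 * \<epsilon>"
        using x[rule_format, of k] y[rule_format, of k]
          dist_triangle[of "(g ^^ k) (x + t *\<^sub>R v)" "(g ^^ k) x" p]
        unfolding d_def mem_cball dist_norm[symmetric] by (simp add: dist_commute)
      then have "(norm (d k))\<^sup>2 \<le> (2 * \<epsilon>)\<^sup>2" by (intro power_mono) auto
      then have "\<bar>K\<bar> * (norm (d k))\<^sup>2 \<le> \<bar>K\<bar> * (2 * \<epsilon>)\<^sup>2" by (intro mult_left_mono) auto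
      moreover have "K * (norm (d k))\<^sup>2 \<le> \<bar>K\<bar> * (norm (d k))\<^sup>2" by (intro mult_right_mono) auto
      ultimately show ?thesis using grow[of k] QK[of "d k"] by linarith
    qed
    obtain n where "\<bar>K\<bar> * (2 * \<epsilon>)\<^sup>2 / Q (d 0) < \<mu> ^ n" using real_arch_pow[OF \<mu>] by blast
    then show False using up[of n] Q0 by (simp add: field_simps)
  qed
qed

text \<open>The translates by \<open>v / n\<close> are pairwise disjoint, of equal measure, and lie in one ball.\<close>

lemma negligible_if_translates_disjoint:
  fixes S :: "'a::euclidean_space set"
  assumes S: "compact S" and v: "v \<noteq> 0"
    and uniq: "\<And>x t. x \<in> S \<Longrightarrow> x + t *\<^sub>R v \<in> S \<Longrightarrow> t = 0"
  shows "negligible S"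
proof -
  define A where "A n = (+) ((1 / real (Suc n)) *\<^sub>R v) ` S" for n
  have meas: "A n \<in> lmeasurable" for n
    unfolding A_def by (intro lmeasurable_compact compact_translation S)
  have mA: "measure lebesgue (A n) = measure lebesgue S" for n
    unfolding A_def by (rule measure_translation)
  have disj: "disjoint_family_on A UNIV"
    unfolding disjoint_family_on_def
  proof (intro ballI impI)
    fix i j :: nat assume "i \<noteq> j"
    show "A i \<inter> A j = {}"
    proof (rule ccontr)
      assume "A i \<inter> A j \<noteq> {}"
      then obtain x y where xy: "x \<in> S" "y \<in> S" "(1 / real (Suc i)) *\<^sub>R v + x = (1 / real (Suc j)) *\<^sub>R v + y"
        by (auto simp: A_def)
      then have "y = x + (1 / real (Suc i) - 1 / real (Suc j)) *\<^sub>R v" by (simp add: algebra_simps)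
      then have "1 / real (Suc i) - 1 / real (Suc j) = 0" using uniq xy by blast
      then show False using \<open>i \<noteq> j\<close> by (simp add: frac_eq_eq del: of_nat_Suc)
    qed
  qed
  obtain R where "\<forall>x\<in>S. norm x \<le> R"
    using compact_imp_bounded[OF S] unfolding bounded_iff by blast
  then have R: "S \<subseteq> cball 0 R" by auto
  have sub: "A n \<subseteq> cball 0 (norm v + R)" for n
  proof
    fix y assume "y \<in> A n"
    then obtain x where x: "x \<in> S" "y = (1 / real (Suc n)) *\<^sub>R v + x" by (auto simp: A_def)
    have "norm y \<le> norm ((1 / real (Suc n)) *\<^sub>R v) + norm x" unfolding x(2) by (rule norm_triangle_ineq)
    also have "norm ((1 / real (Suc n)) *\<^sub>R v) \<le> norm v"
      by (simp add: divide_le_eq mult_left_le algebra_simps)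
    also have "norm x \<le> R" using R x by auto
    finally show "y \<in> cball 0 (norm v + R)" by simp
  qed
  have bound: "real N * measure lebesgue S \<le> measure lebesgue (cball (0::'a) (norm v + R))" for N
  proof -
    have "measure lebesgue (\<Union>n<N. A n) = (\<Sum>n<N. measure lebesgue (A n))"
    proof (rule measure_finite_Union)
      show "A ` {..<N} \<subseteq> sets lebesgue" using meas by (auto intro: fmeasurableD)
      show "disjoint_family_on A {..<N}" using disj by (rule disjoint_family_on_mono[rotated]) simp
      show "emeasure lebesgue (A i) \<noteq> \<infinity>" for i using fmeasurableD2[OF meas[of i]] by simp
    qed simp
    also have "\<dots> = real N * measure lebesgue S" by (simp add: mA)
    finally have "real N * measure lebesgue S = measure lebesgue (\<Union>n<N. A n)" by simp
    also have "\<dots> \<le> measure lebesgue (cball (0::'a) (norm v + R))"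
      by (rule measure_mono_fmeasurable) (use sub meas in \<open>auto intro: fmeasurableD\<close>)
    finally show ?thesis .
  qed
  have "measure lebesgue S = 0"
  proof (rule ccontr)
    assume "measure lebesgue S \<noteq> 0"
    then have "measure lebesgue S > 0" using measure_nonneg[of lebesgue S] by linarith
    then obtain N where "measure lebesgue (cball (0::'a) (norm v + R)) < real N * measure lebesgue S"
      using reals_Archimedean3 by blast
    then show False using bound[of N] by linarith
  qed
  then show ?thesis using S by (simp add: negligible_iff_measure0 lmeasurable_compact)
qed

text \<open>The map \<open>H\<close> is a lift of \<open>g\<close> along \<open>\<pi>\<close>. Null sets are taken upstairs, since the relevant starting
  points form a null set downstairs when \<open>\<pi>\<close> is not surjective; the saddles live downstairs, where
  the derivative of \<open>g\<close> is self-adjoint. An expanding direction must therefore lie in the image of \<open>\<pi>\<close>.\<close>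

theorem strict_saddles_avoided:
  fixes \<pi> :: "'b::euclidean_space \<Rightarrow> 'a::euclidean_space"
    and g :: "'a \<Rightarrow> 'a" and H :: "'b \<Rightarrow> 'b"
  assumes lin: "linear \<pi>"
    and der: "\<And>x. (g has_derivative g' x) (at x)" and cont: "\<And>d. continuous_on UNIV (\<lambda>x. g' x d)"
    and derH: "\<And>w. (H has_derivative H' w) (at w)" and injH: "\<And>w. w \<in> cball 0 R \<Longrightarrow> inj (H' w)"
    and conj: "\<And>w. \<pi> (H w) = g (\<pi> w)"
    and saddle: "\<And>p. p \<in> P \<Longrightarrow> (\<forall>x y. inner (g' p x) y = inner x (g' p y)) \<and> (\<exists>u. norm (g' p (\<pi> u)) > norm (\<pi> u))"
  shows "negligible {w. (\<forall>k. (H ^^ k) w \<in> cball 0 R) \<and> (\<exists>p\<in>P. (\<lambda>k. \<pi> ((H ^^ k) w)) \<longlonglongrightarrow> p)}"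
proof -
  have conjk: "\<pi> ((H ^^ k) w) = (g ^^ k) (\<pi> w)" for k w
    by (induction k) (simp_all add: conj)
  have contg: "continuous_on UNIV (g ^^ k)" for k
  proof (induction k)
    case (Suc k)
    have "continuous_on UNIV g" by (intro continuous_at_imp_continuous_on ballI has_derivative_continuous[OF der])
    then show ?case using Suc by (simp add: continuous_on_compose2[of UNIV g UNIV "g ^^ k"] comp_def)
  qed (simp add: continuous_on_id id_def)
  have cont\<pi>: "continuous_on UNIV \<pi>" using lin by (simp add: linear_continuous_on linear_linear)
  define W where "W p \<epsilon> = {w \<in> cball 0 R. \<forall>k. (g ^^ k) (\<pi> w) \<in> cball p \<epsilon>}" for p \<epsilon>
  have "\<exists>\<epsilon>>0. negligible (W p \<epsilon>)" if p: "p \<in> P" for p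
  proof -
    obtain u where sa: "\<And>x y. inner (g' p x) y = inner x (g' p y)" and u: "norm (g' p (\<pi> u)) > norm (\<pi> u)"
      using saddle[OF p] by blast
    obtain \<epsilon> where \<epsilon>: "\<epsilon> > 0" and uniq:
      "\<And>x t. \<lbrakk>\<forall>k. (g ^^ k) x \<in> cball p \<epsilon>; \<forall>k. (g ^^ k) (x + t *\<^sub>R \<pi> u) \<in> cball p \<epsilon>\<rbrakk> \<Longrightarrow> t = 0"
      using orbits_near_strict_saddle[OF der cont sa u] by metis
    have "negligible (W p \<epsilon>)"
    proof (rule negligible_if_translates_disjoint)
      have W: "W p \<epsilon> = cball 0 R \<inter> (\<Inter>k. (\<lambda>w. (g ^^ k) (\<pi> w)) -` cball p \<epsilon>)" by (auto simp: W_def)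
      have "closed ((\<lambda>w. (g ^^ k) (\<pi> w)) -` cball p \<epsilon>)" for k
        by (intro closed_vimage continuous_on_compose2[OF contg cont\<pi>]) auto
      then show "compact (W p \<epsilon>)" unfolding W by (intro compact_Int_closed closed_INT) auto
      show "u \<noteq> 0"
      proof
        assume "u = 0"
        then have "\<pi> u = 0" using linear_0[OF lin] by simp
        moreover have "g' p 0 = 0" using der has_derivative_linear linear_0 by blast
        ultimately show False using u by simp
      qed
      show "t = 0" if "x \<in> W p \<epsilon>" "x + t *\<^sub>R u \<in> W p \<epsilon>" for x t
        by (rule uniq[of "\<pi> x"]) (use that in \<open>simp_all add: W_def linear_add[OF lin] linear_scale[OF lin]\<close>)
    qed
    then show ?thesis using \<epsilon> by blast
  qed
  then obtain \<epsilon> where \<epsilon>: "\<And>p. p \<in> P \<Longrightarrow> \<epsilon> p > 0 \<and> negligible (W p (\<epsilon> p))" by metis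
  obtain F where F: "F \<subseteq> (\<lambda>p. ball p (\<epsilon> p)) ` P" "countable F" "\<Union>F = \<Union>((\<lambda>p. ball p (\<epsilon> p)) ` P)"
    using Lindelof[of "(\<lambda>p. ball p (\<epsilon> p)) ` P"] by blast
  then obtain P' where P': "P' \<subseteq> P" "countable P'" "F = (\<lambda>p. ball p (\<epsilon> p)) ` P'"
    using countable_subset_image[of F "\<lambda>p. ball p (\<epsilon> p)" P] by blast
  \<comment> \<open>starting points whose orbits stay near \<open>p\<close> from time \<open>k\<close> on\<close>
  define T where "T p k = {w. (\<forall>i. (H ^^ i) w \<in> cball 0 R) \<and> (H ^^ k) w \<in> W p (\<epsilon> p)}" for p k
  have negT: "negligible (T p k)" if p: "p \<in> P" for p k
  proof (induction k)
    case 0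
    show ?case using \<epsilon>[OF p] by (auto intro: negligible_subset simp: T_def)
  next
    case (Suc k)
    have "negligible {w \<in> cball 0 R. H w \<in> T p k}"
      by (rule negligible_differentiable_vimage[OF Suc])
        (rule injH, assumption, rule has_derivative_at_withinI[OF derH])
    moreover have "T p (Suc k) \<subseteq> {w \<in> cball 0 R. H w \<in> T p k}"
    proof
      fix w assume w: "w \<in> T p (Suc k)"
      have sw: "(H ^^ i) (H w) = (H ^^ Suc i) w" for i by (simp add: funpow_swap1)
      have i: "(H ^^ i) w \<in> cball 0 R" for i using w unfolding T_def by blast
      have "(H ^^ Suc k) w \<in> W p (\<epsilon> p)" using w unfolding T_def by blast
      then show "w \<in> {w \<in> cball 0 R. H w \<in> T p k}"
        using i[of 0] i[of "Suc _"] unfolding T_def mem_Collect_eq sw by simp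
    qed
    ultimately show ?case by (rule negligible_subset)
  qed
  have "negligible (\<Union>p\<in>P'. \<Union>k. T p k)"
    by (intro negligible_countable_Union) (use P' negT in \<open>auto intro!: negligible_countable_Union\<close>)
  moreover have "{w. (\<forall>k. (H ^^ k) w \<in> cball 0 R) \<and> (\<exists>p\<in>P. (\<lambda>k. \<pi> ((H ^^ k) w)) \<longlonglongrightarrow> p)} \<subseteq> (\<Union>p\<in>P'. \<Union>k. T p k)"
  proof clarify
    fix w q assume w: "\<forall>k. (H ^^ k) w \<in> cball 0 R" and q: "q \<in> P" "(\<lambda>k. \<pi> ((H ^^ k) w)) \<longlonglongrightarrow> q"
    have "q \<in> \<Union>F" unfolding F(3) using q(1) \<epsilon>[OF q(1)] by force
    then obtain p where p: "p \<in> P'" "q \<in> ball p (\<epsilon> p)" unfolding P'(3) by blast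
    have "\<forall>\<^sub>F k in sequentially. \<pi> ((H ^^ k) w) \<in> ball p (\<epsilon> p)"
      using q(2) p(2) by (rule topological_tendstoD[OF _ open_ball])
    then obtain N where N: "\<And>k. k \<ge> N \<Longrightarrow> \<pi> ((H ^^ k) w) \<in> ball p (\<epsilon> p)"
      by (auto simp: eventually_sequentially)
    have "(g ^^ k) (\<pi> ((H ^^ N) w)) \<in> cball p (\<epsilon> p)" for k
    proof -
      have "(g ^^ k) (\<pi> ((H ^^ N) w)) = \<pi> ((H ^^ (k + N)) w)"
        by (simp only: funpow_add o_apply conjk)
      also have "\<dots> \<in> cball p (\<epsilon> p)" using N[of "k + N"] ball_subset_cball by auto
      finally show ?thesis .
    qed
    then have "w \<in> T p N" using w by (simp add: T_def W_def)
    then show "w \<in> (\<Union>p\<in>P'. \<Union>k. T p k)" using p(1) by blast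
  qed
  ultimately show ?thesis by (rule negligible_subset)
qed

section \<open>Boundedness and descent of the iterates\<close>

definition gradient_step ::
  "real ^ 'n ^ 'm \<Rightarrow> real \<Rightarrow> (real ^ 'r ^ 'm) \<times> (real ^ 'n ^ 'r) \<Rightarrow> (real ^ 'r ^ 'm) \<times> (real ^ 'n ^ 'r)" where
  "gradient_step M \<alpha> z = z - \<alpha> *\<^sub>R loss_gradient M z"

lemma gradient_descent_eq_funpow:
  "gradient_descent (fact_loss M) \<alpha> z k = (gradient_step M \<alpha> ^^ k) z"
  by (induction k) (simp_all add: gradient_fact_loss gradient_step_def)

text \<open>A conserved quantity of the gradient flow.\<close>

definition imbalance :: "(real ^ 'r ^ 'm) \<times> (real ^ 'n ^ 'r) \<Rightarrow> real ^ 'r ^ 'r" where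
  "imbalance z = transpose (fst z) ** fst z - snd z ** transpose (snd z)"

lemma norm_prod_square: "(norm z)\<^sup>2 = (norm (fst z))\<^sup>2 + (norm (snd z))\<^sup>2"
  by (cases z) (simp add: norm_Pair)

text \<open>The first-order change cancels because \<open>X\<^sup>T (E Y\<^sup>T) = (X\<^sup>T E) Y\<^sup>T\<close>. What remains is quadratic in the
  step.\<close>

lemma imbalance_gradient_step:
  "norm (imbalance (gradient_step M \<alpha> z)) \<le> norm (imbalance z) + \<alpha>\<^sup>2 * (norm (loss_gradient M z))\<^sup>2"
proof -
  let ?X = "fst z" and ?Y = "snd z" and ?r = "residual M z"
  define U V where "U = \<alpha> *\<^sub>R fst (loss_gradient M z)" and "V = \<alpha> *\<^sub>R snd (loss_gradient M z)"
  have 1: "transpose ?X ** U = V ** transpose ?Y"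
    by (simp add: U_def V_def loss_gradient_def matrix_mult.scaleR_left matrix_mult.scaleR_right matrix_mul_assoc)
  then have "transpose (transpose ?X ** U) = transpose (V ** transpose ?Y)" by simp
  then have 2: "transpose U ** ?X = ?Y ** transpose V" by (simp add: matrix_transpose_mul)
  have "imbalance (gradient_step M \<alpha> z) = imbalance z + (transpose U ** U - V ** transpose V)"
    unfolding imbalance_def gradient_step_def
    by (simp add: transpose_diff matrix_mult.diff_left matrix_mult.diff_right 1 2 flip: U_def V_def)
  also have "norm \<dots> \<le> norm (imbalance z) + (norm U * norm U + norm V * norm V)"
    by (rule order_trans[OF norm_triangle_ineq add_left_mono[OF order_trans[OF norm_triangle_ineq4 add_mono]]])
      (metis norm_matrix_mult_le norm_transpose)+
  also have "norm U * norm U + norm V * norm V = \<alpha>\<^sup>2 * (norm (loss_gradient M z))\<^sup>2"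
    by (simp add: norm_prod_square[of "loss_gradient M z"] U_def V_def power_mult_distrib distrib_left
        flip: power2_eq_square)
  finally show ?thesis .
qed

text \<open>Since \<open>\<langle>X\<^sup>T X, Y Y\<^sup>T\<rangle> = \<parallel>X Y\<parallel>\<^sup>2\<close>, the imbalance satisfies
  \<open>\<parallel>X\<^sup>T X\<parallel>\<^sup>2 + \<parallel>Y Y\<^sup>T\<parallel>\<^sup>2 = \<parallel>X\<^sup>T X - Y Y\<^sup>T\<parallel>\<^sup>2 + 2 \<parallel>X Y\<parallel>\<^sup>2\<close>, and the traces of \<open>X\<^sup>T X\<close> and \<open>Y Y\<^sup>T\<close> are
  the squared norms of \<open>X\<close> and \<open>Y\<close>. The loss bounds \<open>X Y\<close>.\<close>

lemma norm_le_residual_imbalance: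
  fixes M :: "real ^ 'n ^ 'm" and z :: "(real ^ 'r ^ 'm) \<times> (real ^ 'n ^ 'r)"
  shows "(norm z)\<^sup>2 \<le> 2 * norm (mat 1 :: real ^ 'r ^ 'r) *
           (norm (imbalance z) + 2 * (norm (residual M z) + norm M))"
proof -
  let ?X = "fst z" and ?Y = "snd z"
  let ?P = "transpose ?X ** ?X" and ?Q = "?Y ** transpose ?Y"
  have "inner ?P ?Q = inner (?P ** ?Y) ?Y" by (rule inner_matrix_mult_left_factor[symmetric])
  also have "\<dots> = inner (?X ** ?Y) (?X ** ?Y)"
    by (simp add: inner_transpose_mult_left flip: matrix_mul_assoc)
  finally have "inner ?P ?Q = inner (?X ** ?Y) (?X ** ?Y)" .
  then have PQ: "inner ?P ?Q = (norm (?X ** ?Y))\<^sup>2" by (simp add: power2_norm_eq_inner)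
  have XY: "norm (?X ** ?Y) \<le> norm (residual M z) + norm M"
    using norm_triangle_ineq[of "residual M z" M] by (simp add: residual_def)
  have D: "(norm (imbalance z))\<^sup>2 = (norm ?P)\<^sup>2 - 2 * (norm (?X ** ?Y))\<^sup>2 + (norm ?Q)\<^sup>2"
    unfolding imbalance_def using norm_diff_scaleR_square[of ?P 1 ?Q] PQ by simp
  have "(norm ?P)\<^sup>2 + (norm ?Q)\<^sup>2 \<le> (norm (imbalance z) + 2 * norm (?X ** ?Y))\<^sup>2"
  proof -
    have "0 \<le> norm (imbalance z) * norm (?X ** ?Y)" by simp
    then show ?thesis using D by (simp add: power2_sum)
  qed
  then have sq: "(norm ?P)\<^sup>2 \<le> (norm (imbalance z) + 2 * norm (?X ** ?Y))\<^sup>2"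
    "(norm ?Q)\<^sup>2 \<le> (norm (imbalance z) + 2 * norm (?X ** ?Y))\<^sup>2"
    using zero_le_power2[of "norm ?P"] zero_le_power2[of "norm ?Q"] by linarith+
  have "norm ?P \<le> norm (imbalance z) + 2 * norm (?X ** ?Y)"
    "norm ?Q \<le> norm (imbalance z) + 2 * norm (?X ** ?Y)"
    by (rule power2_le_imp_le[OF sq(1)], simp) (rule power2_le_imp_le[OF sq(2)], simp)
  then have "norm ?P + norm ?Q \<le> 2 * (norm (imbalance z) + 2 * norm (?X ** ?Y))" by simp
  also have "\<dots> \<le> 2 * (norm (imbalance z) + 2 * (norm (residual M z) + norm M))"
    by (intro mult_left_mono add_left_mono XY) auto
  finally have PQle: "norm ?P + norm ?Q \<le> 2 * (norm (imbalance z) + 2 * (norm (residual M z) + norm M))" .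
  let ?I = "mat 1 :: real ^ 'r ^ 'r"
  have "(norm ?X)\<^sup>2 = inner (?X ** ?I) ?X" by (simp add: power2_norm_eq_inner)
  also have "\<dots> = inner ?I ?P" by (rule inner_matrix_mult_right_factor)
  also have "\<dots> \<le> norm ?I * norm ?P" by (rule norm_cauchy_schwarz)
  finally have X: "(norm ?X)\<^sup>2 \<le> norm ?I * norm ?P" .
  have "(norm ?Y)\<^sup>2 = inner (?I ** ?Y) ?Y" by (simp add: power2_norm_eq_inner)
  also have "\<dots> = inner ?I ?Q" by (rule inner_matrix_mult_left_factor)
  also have "\<dots> \<le> norm ?I * norm ?Q" by (rule norm_cauchy_schwarz)
  finally have "(norm z)\<^sup>2 \<le> norm ?I * (norm ?P + norm ?Q)"
    using X by (simp add: norm_prod_square distrib_left)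
  also have "\<dots> \<le> norm ?I * (2 * (norm (imbalance z) + 2 * (norm (residual M z) + norm M)))"
    by (intro mult_left_mono PQle) simp
  finally show ?thesis by (simp add: algebra_simps)
qed

lemma norm_residual_le:
  assumes "norm z \<le> R"
  shows "norm (residual M z) \<le> R\<^sup>2 + norm M"
proof -
  have X: "norm (fst z) \<le> R" and Y: "norm (snd z) \<le> R"
    using assms norm_fst_le[of "fst z" "snd z"] norm_snd_le[of "snd z" "fst z"] by auto
  have "0 \<le> R" using X norm_ge_zero order_trans by blast
  then have "norm (fst z ** snd z) \<le> R * R"
    by (intro order_trans[OF norm_matrix_mult_le] mult_mono) (use X Y in auto)
  then show ?thesis unfolding residual_def using norm_triangle_ineq4[of "fst z ** snd z" M]
    by (simp add: power2_eq_square)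
qed

text \<open>Exact expansion of the quartic loss along the step; the hypotheses on \<open>\<alpha>\<close> make the terms beyond the first
  order at most half of the first-order decrease.\<close>

lemma fact_loss_gradient_step:
  assumes zR: "norm z \<le> R" and \<alpha>: "\<alpha> > 0" and small1: "\<alpha> * (4 * R * (R\<^sup>2 + norm M)) \<le> 1"
    and small2: "\<alpha> * (2 * (R\<^sup>2 + norm M) + (1 + 2 * R)\<^sup>2) \<le> 1 / 2"
  shows "\<alpha> / 2 * (norm (loss_gradient M z))\<^sup>2 \<le> fact_loss M z - fact_loss M (gradient_step M \<alpha> z)"
proof -
  let ?X = "fst z" and ?Y = "snd z" and ?r = "residual M z" and ?g = "loss_gradient M z"
  define \<rho> where "\<rho> = R\<^sup>2 + norm M"
  define \<gamma> where "\<gamma> = norm ?g"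
  define U V where "U = \<alpha> *\<^sub>R fst ?g" and "V = \<alpha> *\<^sub>R snd ?g"
  define W where "W = U ** ?Y + ?X ** V"
  have X: "norm ?X \<le> R" and Y: "norm ?Y \<le> R"
    using zR norm_fst_le[of "fst z" "snd z"] norm_snd_le[of "snd z" "fst z"] by auto
  have R: "0 \<le> R" using X norm_ge_zero order_trans by blast
  have \<rho>: "norm ?r \<le> \<rho>" unfolding \<rho>_def by (rule norm_residual_le[OF zR])
  have \<rho>0: "0 \<le> \<rho>" using \<rho> norm_ge_zero order_trans by blast
  have g0: "\<gamma> \<ge> 0" by (simp add: \<gamma>_def)
  have U: "norm U \<le> \<alpha> * \<gamma>" and V: "norm V \<le> \<alpha> * \<gamma>"
    using \<alpha> norm_fst_le[of "fst ?g" "snd ?g"] norm_snd_le[of "snd ?g" "fst ?g"]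
    by (simp_all add: U_def V_def \<gamma>_def)
  have "\<gamma> \<le> norm (fst ?g) + norm (snd ?g)"
    unfolding \<gamma>_def by (metis norm_Pair_le prod.collapse)
  also have "\<dots> \<le> 2 * (\<rho> * R) + 2 * (R * \<rho>)"
  proof (rule add_mono)
    have "norm (?r ** transpose ?Y) \<le> \<rho> * R"
      by (intro order_trans[OF norm_matrix_mult_le] mult_mono) (use \<rho> Y \<rho>0 in auto)
    then show "norm (fst ?g) \<le> 2 * (\<rho> * R)" by (simp add: loss_gradient_def)
    have "norm (transpose ?X ** ?r) \<le> R * \<rho>"
      by (intro order_trans[OF norm_matrix_mult_le] mult_mono) (use \<rho> X R in auto)
    then show "norm (snd ?g) \<le> 2 * (R * \<rho>)" by (simp add: loss_gradient_def)
  qed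
  finally have "\<alpha> * \<gamma> \<le> \<alpha> * (4 * R * \<rho>)" using \<alpha> by simp
  then have ag: "\<alpha> * \<gamma> \<le> 1" using small1 by (simp add: \<rho>_def)
  have ag0: "0 \<le> \<alpha> * \<gamma>" using \<alpha> g0 by simp
  have res: "residual M (gradient_step M \<alpha> z) = ?r - (W - U ** V)"
    by (simp add: residual_def gradient_step_def W_def matrix_mult.diff_left matrix_mult.diff_right flip: U_def V_def)
  have rW: "2 * inner ?r W = \<alpha> * \<gamma>\<^sup>2"
  proof -
    have "2 * inner ?r (U ** ?Y) = \<alpha> * (norm (fst ?g))\<^sup>2"
      unfolding inner_commute[of ?r] inner_matrix_mult_left_factor
      by (simp add: U_def loss_gradient_def power2_norm_eq_inner)
    moreover have "2 * inner ?r (?X ** V) = \<alpha> * (norm (snd ?g))\<^sup>2"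
      unfolding inner_commute[of ?r] inner_matrix_mult_right_factor
      by (simp add: V_def loss_gradient_def power2_norm_eq_inner)
    ultimately show ?thesis
      unfolding \<gamma>_def W_def norm_prod_square by (simp add: inner_add_right distrib_left)
  qed
  have UV: "norm (U ** V) \<le> (\<alpha> * \<gamma>) * (\<alpha> * \<gamma>)"
    by (intro order_trans[OF norm_matrix_mult_le] mult_mono) (use U V ag0 in auto)
  have rUV: "inner ?r (U ** V) \<le> \<rho> * ((\<alpha> * \<gamma>) * (\<alpha> * \<gamma>))"
    by (rule order_trans[OF norm_cauchy_schwarz mult_mono]) (use \<rho> UV \<rho>0 in auto)
  have "norm (W - U ** V) \<le> (\<alpha> * \<gamma>) * (1 + 2 * R)"
  proof -
    have "norm (U ** ?Y) \<le> (\<alpha> * \<gamma>) * R"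
      by (intro order_trans[OF norm_matrix_mult_le] mult_mono) (use U Y ag0 in auto)
    moreover have "norm (?X ** V) \<le> R * (\<alpha> * \<gamma>)"
      by (intro order_trans[OF norm_matrix_mult_le] mult_mono) (use V X R in auto)
    moreover have "(\<alpha> * \<gamma>) * (\<alpha> * \<gamma>) \<le> (\<alpha> * \<gamma>) * 1" using ag ag0 by (intro mult_left_mono) auto
    moreover have "norm (W - U ** V) \<le> norm (U ** ?Y) + norm (?X ** V) + norm (U ** V)"
      unfolding W_def by (intro order_trans[OF norm_triangle_ineq4] add_right_mono norm_triangle_ineq)
    moreover have "(\<alpha> * \<gamma>) * (1 + 2 * R) = (\<alpha> * \<gamma>) * 1 + (\<alpha> * \<gamma>) * R + R * (\<alpha> * \<gamma>)" by (simp add: algebra_simps)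
    ultimately show ?thesis using UV by linarith
  qed
  then have Wsq: "(norm (W - U ** V))\<^sup>2 \<le> (\<alpha> * \<gamma>)\<^sup>2 * (1 + 2 * R)\<^sup>2"
    by (metis norm_ge_zero power_mono power_mult_distrib)
  have "fact_loss M (gradient_step M \<alpha> z)
      = fact_loss M z - 2 * inner ?r W + 2 * inner ?r (U ** V) + (norm (W - U ** V))\<^sup>2"
    unfolding fact_loss_eq res using norm_diff_scaleR_square[of ?r 1 "W - U ** V"]
    by (simp add: inner_diff_right)
  also have "\<dots> \<le> fact_loss M z - \<alpha> * \<gamma>\<^sup>2 + 2 * (\<rho> * ((\<alpha> * \<gamma>) * (\<alpha> * \<gamma>))) + (\<alpha> * \<gamma>)\<^sup>2 * (1 + 2 * R)\<^sup>2"
    using rW rUV Wsq by linarith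
  also have "\<dots> = fact_loss M z - \<alpha> * \<gamma>\<^sup>2 + (\<alpha> * \<gamma>\<^sup>2) * (\<alpha> * (2 * \<rho> + (1 + 2 * R)\<^sup>2))"
    by (simp add: power_mult_distrib) (simp add: power2_eq_square algebra_simps)
  also have "\<dots> \<le> fact_loss M z - \<alpha> * \<gamma>\<^sup>2 + (\<alpha> * \<gamma>\<^sup>2) * (1 / 2)"
    using small2 \<alpha> by (intro add_left_mono mult_left_mono) (auto simp: \<rho>_def)
  finally show ?thesis by (simp add: \<gamma>_def)
qed

lemma small_positive_factor:
  fixes c :: "real"
  assumes "d > 0"
  obtains b where "b > 0" "\<And>\<alpha>. 0 < \<alpha> \<Longrightarrow> \<alpha> \<le> b \<Longrightarrow> \<alpha> * c \<le> d"
proof (rule that[of "d / (\<bar>c\<bar> + 1)"])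
  show "\<alpha> * c \<le> d" if "0 < \<alpha>" "\<alpha> \<le> d / (\<bar>c\<bar> + 1)" for \<alpha>
  proof -
    have "\<alpha> * c \<le> \<alpha> * (\<bar>c\<bar> + 1)" using that by (intro mult_left_mono) auto
    also have "\<dots> \<le> d" using that by (simp add: field_simps)
    finally show ?thesis .
  qed
qed (use assms in auto)

text \<open>The inductive invariant is that the imbalance has grown by at most \<open>2 \<alpha>\<close> times the decrease of the
  loss so far. It bounds the current iterate by \<open>R\<close>, which makes the next step a descent step, which
  in turn preserves the invariant. The radius \<open>R\<close> is fixed before the step size.\<close>

theorem gradient_descent_bounded_and_decreasing:
  fixes M :: "real ^ 'n ^ 'm" and S :: real
  shows "\<exists>R b. b > 0 \<and> (\<forall>\<alpha> (z :: (real ^ 'r ^ 'm) \<times> (real ^ 'n ^ 'r)) k.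
     0 < \<alpha> \<longrightarrow> \<alpha> \<le> b \<longrightarrow> norm z \<le> S \<longrightarrow>
     norm ((gradient_step M \<alpha> ^^ k) z) \<le> R \<and>
     \<alpha> / 2 * (norm (loss_gradient M ((gradient_step M \<alpha> ^^ k) z)))\<^sup>2
       \<le> fact_loss M ((gradient_step M \<alpha> ^^ k) z) - fact_loss M ((gradient_step M \<alpha> ^^ Suc k) z))"
proof -
  \<comment> \<open>\<open>s\<close> bounds the residual and \<open>D\<close> the imbalance along the whole orbit, as the loss never exceeds \<open>s\<^sup>2\<close>\<close>
  define s where "s = S\<^sup>2 + norm M"
  define D where "D = 2 * S\<^sup>2 + 2 * s\<^sup>2"
  define R where "R = sqrt (2 * norm (mat 1 :: real ^ 'r ^ 'r) * (D + 2 * (s + norm M)))"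
  have s0: "s \<ge> 0" by (simp add: s_def)
  obtain b1 where b1: "b1 > 0" "\<And>\<alpha>. 0 < \<alpha> \<Longrightarrow> \<alpha> \<le> b1 \<Longrightarrow> \<alpha> * (4 * R * (R\<^sup>2 + norm M)) \<le> 1"
    using small_positive_factor[of 1] by (metis zero_less_one)
  obtain b2 where b2: "b2 > 0" "\<And>\<alpha>. 0 < \<alpha> \<Longrightarrow> \<alpha> \<le> b2 \<Longrightarrow> \<alpha> * (2 * (R\<^sup>2 + norm M) + (1 + 2 * R)\<^sup>2) \<le> 1 / 2"
    using small_positive_factor[of "1/2"] by (metis half_gt_zero zero_less_one)
  show ?thesis
  proof (rule exI[of _ R], rule exI[of _ "min 1 (min b1 b2)"], intro conjI[rotated] allI impI)
    show "min 1 (min b1 b2) > 0" using b1 b2 by simp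
    fix \<alpha> and z :: "(real ^ 'r ^ 'm) \<times> (real ^ 'n ^ 'r)" and k
    assume \<alpha>: "0 < \<alpha>" "\<alpha> \<le> min 1 (min b1 b2)" and z: "norm z \<le> S"
    let ?z = "\<lambda>k. (gradient_step M \<alpha> ^^ k) z"
    let ?f = "\<lambda>k. fact_loss M (?z k)"
    have S: "0 \<le> S" using z norm_ge_zero order_trans by blast
    have fpos: "?f k \<ge> 0" for k by (simp add: fact_loss_eq)
    have f0: "?f 0 \<le> s\<^sup>2" unfolding fact_loss_eq s_def
      by (intro power_mono) (use norm_residual_le[OF z] in auto)
    have D0: "norm (imbalance z) \<le> 2 * S\<^sup>2"
    proof -
      have x: "norm (fst z) \<le> S" "norm (snd z) \<le> S"
        using z norm_fst_le[of "fst z" "snd z"] norm_snd_le[of "snd z" "fst z"] by auto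
      have "norm (transpose (fst z) ** fst z) \<le> S * S" "norm (snd z ** transpose (snd z)) \<le> S * S"
        by (rule order_trans[OF norm_matrix_mult_le mult_mono]; use x S in simp)+
      then show ?thesis unfolding imbalance_def
        using norm_triangle_ineq4[of "transpose (fst z) ** fst z" "snd z ** transpose (snd z)"]
        by (simp add: power2_eq_square)
    qed
    have step: "norm (?z k) \<le> R \<and> \<alpha> / 2 * (norm (loss_gradient M (?z k)))\<^sup>2 \<le> ?f k - ?f (Suc k)"
      if inv: "?f k \<le> ?f 0" "norm (imbalance (?z k)) \<le> norm (imbalance z) + 2 * \<alpha> * (?f 0 - ?f k)" for k
    proof -
      have "2 * \<alpha> * (?f 0 - ?f k) \<le> 2 * 1 * (?f 0 - ?f k)"
        using inv(1) \<alpha> by (intro mult_right_mono) auto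
      also have "\<dots> \<le> 2 * s\<^sup>2" using f0 fpos[of k] by simp
      finally have "norm (imbalance (?z k)) \<le> D"
        using order_trans[OF inv(2) add_mono[OF D0]] by (simp add: D_def)
      moreover have "norm (residual M (?z k)) \<le> s"
      proof (rule power2_le_imp_le[OF _ s0])
        show "(norm (residual M (?z k)))\<^sup>2 \<le> s\<^sup>2"
          using order_trans[OF inv(1) f0] by (simp only: fact_loss_eq)
      qed
      ultimately have "norm (imbalance (?z k)) + 2 * (norm (residual M (?z k)) + norm M) \<le> D + 2 * (s + norm M)"
        by (intro add_mono mult_left_mono) auto
      from mult_left_mono[OF this, of "2 * norm (mat 1 :: real ^ 'r ^ 'r)"]
      have "(norm (?z k))\<^sup>2 \<le> 2 * norm (mat 1 :: real ^ 'r ^ 'r) * (D + 2 * (s + norm M))"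
        using norm_le_residual_imbalance[of "?z k" M] by simp
      then have "norm (?z k) \<le> R" unfolding R_def by (rule real_le_rsqrt)
      then show ?thesis
        using fact_loss_gradient_step[of "?z k" R \<alpha> M] \<alpha> b1(2)[of \<alpha>] b2(2)[of \<alpha>] by simp
    qed
    have inv: "?f k \<le> ?f 0 \<and> norm (imbalance (?z k)) \<le> norm (imbalance z) + 2 * \<alpha> * (?f 0 - ?f k)" for k
    proof (induction k)
      case (Suc k)
      have desc: "\<alpha> / 2 * (norm (loss_gradient M (?z k)))\<^sup>2 \<le> ?f k - ?f (Suc k)"
        using step[of k] Suc by blast
      have "0 \<le> \<alpha> / 2 * (norm (loss_gradient M (?z k)))\<^sup>2" using \<alpha> by simp
      then have 1: "?f (Suc k) \<le> ?f 0" using desc Suc by linarith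
      have "norm (imbalance (?z (Suc k))) \<le> norm (imbalance (?z k)) + \<alpha>\<^sup>2 * (norm (loss_gradient M (?z k)))\<^sup>2"
        using imbalance_gradient_step[of M \<alpha> "?z k"] by simp
      also have "\<alpha>\<^sup>2 * (norm (loss_gradient M (?z k)))\<^sup>2 = 2 * \<alpha> * (\<alpha> / 2 * (norm (loss_gradient M (?z k)))\<^sup>2)"
        by (simp add: power2_eq_square)
      also have "\<dots> \<le> 2 * \<alpha> * (?f k - ?f (Suc k))" using desc \<alpha> by (intro mult_left_mono) auto
      finally have "norm (imbalance (?z (Suc k))) \<le> norm (imbalance z) + (2 * \<alpha> * (?f 0 - ?f k) + 2 * \<alpha> * (?f k - ?f (Suc k)))"
        using Suc by linarith
      also have "2 * \<alpha> * (?f 0 - ?f k) + 2 * \<alpha> * (?f k - ?f (Suc k)) = 2 * \<alpha> * (?f 0 - ?f (Suc k))"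
        by (simp add: algebra_simps)
      finally show ?case using 1 by blast
    qed simp
    show "norm (?z k) \<le> R" "\<alpha> / 2 * (norm (loss_gradient M (?z k)))\<^sup>2 \<le> ?f k - ?f (Suc k)"
      using step inv by blast+
  qed
qed

section \<open>Convergence to a global minimum\<close>

lemma matrix_generalized_inverse:
  fixes M :: "real ^ 'n ^ 'm"
  obtains N :: "real ^ 'm ^ 'n" where "M ** N ** M = M"
proof -
  obtain g where g: "linear g" "\<And>v. v \<in> range ((*v) M) \<Longrightarrow> M *v (g v) = v"
    using linear_exists_right_inverse_on[of "(*v) M" UNIV] by auto
  have "(M ** matrix g ** M) *v x = M *v x" for x
    using g by (simp add: matrix_works flip: matrix_vector_mul_assoc)
  then have "M ** matrix g ** M = M" by (simp add: matrix_eq)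
  then show ?thesis by (rule that)
qed

lemma gradient_step_has_derivative:
  "(gradient_step M \<alpha> has_derivative (\<lambda>d. d - \<alpha> *\<^sub>R loss_hessian M z d)) (at z)"
  unfolding gradient_step_def
  by (intro has_derivative_diff has_derivative_ident has_derivative_scaleR_right loss_gradient_has_derivative)

lemma negative_curvature_expands:
  assumes "inner (loss_hessian M p d) d < 0" "\<alpha> > 0"
  shows "norm d < norm (d - \<alpha> *\<^sub>R loss_hessian M p d)"
proof (rule power2_less_imp_less)
  have "2 * \<alpha> * inner d (loss_hessian M p d) < 0"
    using assms by (simp add: inner_commute mult_pos_neg)
  moreover have "0 \<le> \<alpha>\<^sup>2 * (norm (loss_hessian M p d))\<^sup>2" by simp
  ultimately show "(norm d)\<^sup>2 < (norm (d - \<alpha> *\<^sub>R loss_hessian M p d))\<^sup>2"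
    unfolding norm_diff_scaleR_square by linarith
qed simp

text \<open>The parametrization \<open>(A, Y) \<mapsto> (M A, Y)\<close> of the invariant set.\<close>

definition mult_fst :: "real ^ 'n ^ 'm \<Rightarrow> (real ^ 'r ^ 'n) \<times> 'c \<Rightarrow> (real ^ 'r ^ 'm) \<times> 'c" where
  "mult_fst M w = (M ** fst w, snd w)"

lemma linear_mult_fst:
  "linear (mult_fst M :: (real ^ 'r ^ 'n) \<times> 'c::real_vector \<Rightarrow> _)"
  by (rule linearI) (simp_all add: mult_fst_def matrix_add_ldistrib matrix_mult.scaleR_right)

text \<open>A generalized inverse of \<open>M\<close> thus inverts the parametrization on its image, and lifts the iteration.\<close>

lemma mult_fst_generalized_inverse:
  "M ** N ** M = M \<Longrightarrow> mult_fst M (mult_fst N (mult_fst M w)) = mult_fst M w"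
  by (simp add: mult_fst_def matrix_mul_assoc)

text \<open>At \<open>X = M A\<close> the residual \<open>M A Y - M\<close> is a left multiple of \<open>M\<close>, so the gradient is tangent to the
  invariant set.\<close>

lemma loss_gradient_mult_fst:
  "loss_gradient M (mult_fst M w) =
     mult_fst M (2 *\<^sub>R ((fst w ** snd w - mat 1) ** transpose (snd w)), snd (loss_gradient M (mult_fst M w)))"
  by (simp add: loss_gradient_def mult_fst_def residual_def matrix_mult.scaleR_right matrix_mul_assoc
      matrix_mult.diff_right matrix_mult.diff_left)

lemma saddle_has_negative_curvature:
  fixes M :: "real ^ 'n ^ 'm" and w :: "(real ^ 'r ^ 'n) \<times> (real ^ 'n ^ 'r)"
  assumes "loss_gradient M (mult_fst M w) = 0" "\<not> is_global_min (fact_loss M) (mult_fst M w)"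
  shows "\<exists>u. inner (loss_hessian M (mult_fst M w) (mult_fst M u)) (mult_fst M u) < 0"
proof (rule ccontr)
  assume "\<not> ?thesis"
  then have *: "inner (loss_hessian M (mult_fst M w) (mult_fst M u)) (mult_fst M u) \<ge> 0" for u
    unfolding not_ex not_less by blast
  have "is_global_min (fact_loss M) (M ** fst w, snd w)"
  proof (rule second_order_critical_imp_global_min)
    show "loss_gradient M (M ** fst w, snd w) = 0" using assms(1) by (simp add: mult_fst_def)
    show "0 \<le> inner (loss_hessian M (M ** fst w, snd w) (M ** U, V)) (M ** U, V)" for U V
      using *[of "(U, V)"] by (simp add: mult_fst_def)
  qed
  then show False using assms(2) by (simp add: mult_fst_def)
qed

text \<open>The estimates in terms of the gradient become estimates in terms of the step through
  \<open>z\<^sub>k\<^sub>+\<^sub>1 - z\<^sub>k = - \<alpha> \<nabla>f(z\<^sub>k)\<close>; the constants may depend on \<open>\<alpha>\<close>.\<close>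

lemma gradient_descent_converges_to_critical:
  fixes M :: "real ^ 'n ^ 'm" and w :: "(real ^ 'r ^ 'n) \<times> (real ^ 'n ^ 'r)"
  assumes \<alpha>: "\<alpha> > 0"
    and bnd: "\<And>k. norm ((gradient_step M \<alpha> ^^ k) (mult_fst M w)) \<le> R"
    and desc: "\<And>k. \<alpha> / 2 * (norm (loss_gradient M ((gradient_step M \<alpha> ^^ k) (mult_fst M w))))\<^sup>2
       \<le> fact_loss M ((gradient_step M \<alpha> ^^ k) (mult_fst M w))
         - fact_loss M ((gradient_step M \<alpha> ^^ Suc k) (mult_fst M w))"
    and range: "\<And>k. (gradient_step M \<alpha> ^^ k) (mult_fst M w) \<in> range (mult_fst M)"
  shows "\<exists>p. converges_linearly_to (\<lambda>k. (gradient_step M \<alpha> ^^ k) (mult_fst M w)) p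
     \<and> (\<lambda>k. (gradient_step M \<alpha> ^^ k) (mult_fst M w)) \<longlonglongrightarrow> p
     \<and> loss_gradient M p = 0 \<and> p \<in> range (mult_fst M)"
proof -
  define z where "z k = (gradient_step M \<alpha> ^^ k) (mult_fst M w)" for k
  obtain C K where C: "finite C" and K: "K \<ge> 0" and Loj:
    "\<And>(A :: real ^ 'r ^ 'n) Y. norm (M ** A, Y) \<le> R \<Longrightarrow>
       \<exists>c\<in>C. \<bar>fact_loss M (M ** A, Y) - c\<bar> \<le> K * (norm (loss_gradient M (M ** A, Y)))\<^sup>2"
    using loss_Lojasiewicz[where M = M and R = R and ?'r = 'r] by metis
  have dz: "z (Suc k) - z k = - (\<alpha> *\<^sub>R loss_gradient M (z k))" for k
    by (simp add: z_def gradient_step_def)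
  have ndz: "(norm (z (Suc k) - z k))\<^sup>2 = \<alpha>\<^sup>2 * (norm (loss_gradient M (z k)))\<^sup>2" for k
    by (simp add: dz power_mult_distrib)
  have "\<exists>p. converges_linearly_to z p \<and> z \<longlonglongrightarrow> p"
  proof (rule descent_finite_levels_converges_linearly)
    show "1 / (2 * \<alpha>) > 0" using \<alpha> by simp
    show "(K + 1) / \<alpha>\<^sup>2 > 0" using \<alpha> K by simp
    show "fact_loss M (z k) \<ge> 0" for k by (simp add: fact_loss_eq)
    show "1 / (2 * \<alpha>) * (norm (z (Suc k) - z k))\<^sup>2 \<le> fact_loss M (z k) - fact_loss M (z (Suc k))" for k
    proof -
      have "1 / (2 * \<alpha>) * (norm (z (Suc k) - z k))\<^sup>2 = \<alpha> / 2 * (norm (loss_gradient M (z k)))\<^sup>2"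
        unfolding ndz using \<alpha> by (simp add: power2_eq_square)
      then show ?thesis using desc[of k] by (simp only: z_def)
    qed
    show "finite C" by (rule C)
    show "\<exists>c\<in>C. \<bar>fact_loss M (z k) - c\<bar> \<le> (K + 1) / \<alpha>\<^sup>2 * (norm (z (Suc k) - z k))\<^sup>2" for k
    proof -
      obtain u where u: "z k = (M ** fst u, snd u)" using range[of k] by (auto simp: z_def mult_fst_def)
      obtain c where c: "c \<in> C" "\<bar>fact_loss M (z k) - c\<bar> \<le> K * (norm (loss_gradient M (z k)))\<^sup>2"
        using Loj[of "fst u" "snd u"] bnd[of k] u by (metis z_def)
      have "K * (norm (loss_gradient M (z k)))\<^sup>2 \<le> (K + 1) * (norm (loss_gradient M (z k)))\<^sup>2"
        by (intro mult_right_mono) auto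
      also have "\<dots> = (K + 1) / \<alpha>\<^sup>2 * (norm (z (Suc k) - z k))\<^sup>2" unfolding ndz using \<alpha> by simp
      finally show ?thesis using c by (intro bexI[of _ c]) auto
    qed
  qed
  then obtain p where p: "converges_linearly_to z p" "z \<longlonglongrightarrow> p" by blast
  have "(\<lambda>k. z (Suc k) - z k) \<longlonglongrightarrow> p - p" by (intro tendsto_diff p(2) LIMSEQ_Suc)
  moreover have "(\<lambda>k. loss_gradient M (z k)) \<longlonglongrightarrow> loss_gradient M p"
  proof -
    have "isCont (loss_gradient M) p"
      using continuous_on_loss_gradient[of UNIV M] unfolding continuous_on_eq_continuous_at[OF open_UNIV] by blast
    then show ?thesis using p(2) by (rule isCont_tendsto_compose)
  qed
  then have "(\<lambda>k. z (Suc k) - z k) \<longlonglongrightarrow> - (\<alpha> *\<^sub>R loss_gradient M p)"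
    unfolding dz by (intro tendsto_intros)
  ultimately have "p - p = - (\<alpha> *\<^sub>R loss_gradient M p)" by (rule LIMSEQ_unique)
  then have crit: "loss_gradient M p = 0" using \<alpha> by simp
  have "closed (range (mult_fst M :: (real ^ 'r ^ 'n) \<times> (real ^ 'n ^ 'r) \<Rightarrow> _))"
    by (intro closed_subspace linear_subspace_image linear_mult_fst subspace_UNIV)
  then have "p \<in> range (mult_fst M :: (real ^ 'r ^ 'n) \<times> (real ^ 'n ^ 'r) \<Rightarrow> _)"
    by (rule closed_sequentially[OF _ _ p(2)]) (use range in \<open>simp add: z_def\<close>)
  then show ?thesis using p crit unfolding z_def by blast
qed

text \<open>The lift \<open>H\<close> moves \<open>A\<close> by the generalized inverse of the step in \<open>X\<close>. So \<open>w - N M w\<close>, up to the parametrization, is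
  constant along an orbit, and the lifted orbits inherit boundedness. The null set is that of the initial points
  whose orbits converge to a critical point that is not a global minimum.\<close>

theorem theorem4p15:
  fixes M :: "real ^ 'n ^ 'm"
    and \<A> :: "(real ^ 'r ^ 'n) set"
    and \<B> :: "(real ^ 'n ^ 'r) set"
  assumes "open (\<A> \<times> \<B>)" and "bounded (\<A> \<times> \<B>)"
  shows "\<exists>\<alpha>bar>0. \<forall>\<alpha>\<in>{0<..\<alpha>bar}.
    (AE (A, B) in lebesgue. (A, B) \<in> \<A> \<times> \<B> \<longrightarrow>
      (\<exists>Z. is_global_min (fact_loss M) Z \<and>
           converges_linearly_to (gradient_descent (fact_loss M) \<alpha> (M ** A, B)) Z))"
proof -
  let ?\<pi> = "mult_fst M :: (real ^ 'r ^ 'n) \<times> (real ^ 'n ^ 'r) \<Rightarrow> _"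
  obtain N :: "real ^ 'm ^ 'n" where N: "M ** N ** M = M" by (rule matrix_generalized_inverse)
  let ?\<nu> = "mult_fst N :: (real ^ 'r ^ 'm) \<times> (real ^ 'n ^ 'r) \<Rightarrow> _"
  obtain S where S: "\<And>w. w \<in> \<A> \<times> \<B> \<Longrightarrow> norm w \<le> S"
    using assms(2) unfolding bounded_iff by blast
  obtain K\<pi> where K\<pi>: "K\<pi> > 0" "\<And>w. norm (?\<pi> w) \<le> K\<pi> * norm w"
    using linear_bounded_pos[OF linear_mult_fst] by blast
  obtain K\<nu> where K\<nu>: "K\<nu> > 0" "\<And>z. norm (?\<nu> z) \<le> K\<nu> * norm z"
    using linear_bounded_pos[OF linear_mult_fst] by blast
  obtain R b where b: "b > 0" and GD:
    "\<And>\<alpha> (z :: (real ^ 'r ^ 'm) \<times> (real ^ 'n ^ 'r)) k. 0 < \<alpha> \<Longrightarrow> \<alpha> \<le> b \<Longrightarrow> norm z \<le> K\<pi> * S \<Longrightarrow>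
     norm ((gradient_step M \<alpha> ^^ k) z) \<le> R \<and>
     \<alpha> / 2 * (norm (loss_gradient M ((gradient_step M \<alpha> ^^ k) z)))\<^sup>2
       \<le> fact_loss M ((gradient_step M \<alpha> ^^ k) z) - fact_loss M ((gradient_step M \<alpha> ^^ Suc k) z)"
    using gradient_descent_bounded_and_decreasing[where S = "K\<pi> * S" and M = M and ?'r = 'r] by metis
  \<comment> \<open>bounds the lifted orbits: a lift of the bounded iterate plus the constant component of \<open>w\<close>\<close>
  define R' where "R' = K\<nu> * R + (S + K\<nu> * (K\<pi> * S))"
  define \<Psi>' where "\<Psi>' w d = ?\<nu> (loss_hessian M (?\<pi> w) (?\<pi> d))" for w d
  have lin\<Psi>: "linear (\<Psi>' w)" for w
    unfolding \<Psi>'_def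
    using linear_compose[OF linear_compose[OF linear_mult_fst linear_loss_hessian] linear_mult_fst]
    by (simp add: o_def)
  have cont\<Psi>: "continuous_on UNIV (\<lambda>w. \<Psi>' w d)" for d
  proof -
    have c\<pi>: "continuous_on UNIV ?\<pi>" and c\<nu>: "continuous_on UNIV ?\<nu>"
      by (simp_all add: linear_continuous_on linear_linear linear_mult_fst)
    have "continuous_on UNIV (\<lambda>w. loss_hessian M (?\<pi> w) (?\<pi> d))"
      by (rule continuous_on_compose2[OF continuous_on_loss_hessian[of UNIV] c\<pi>]) simp
    then show ?thesis unfolding \<Psi>'_def
      by (rule continuous_on_compose2[OF c\<nu>]) simp
  qed
  obtain L where L: "L > 0" "\<And>w d. norm w \<le> R' \<Longrightarrow> norm (\<Psi>' w d) \<le> L * norm d"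
    using C1_derivative_bounded[of \<Psi>' R', OF lin\<Psi> cont\<Psi>] by metis
  have "AE (A, B) in lebesgue. (A, B) \<in> \<A> \<times> \<B> \<longrightarrow>
      (\<exists>Z. is_global_min (fact_loss M) Z \<and>
           converges_linearly_to (gradient_descent (fact_loss M) \<alpha> (M ** A, B)) Z)"
    if \<alpha>: "0 < \<alpha>" "\<alpha> \<le> min b (1 / (2 * L))" for \<alpha>
  proof -
    define g :: "(real ^ 'r ^ 'm) \<times> (real ^ 'n ^ 'r) \<Rightarrow> _" where "g = gradient_step M \<alpha>"
    define g' :: "(real ^ 'r ^ 'm) \<times> (real ^ 'n ^ 'r) \<Rightarrow> _" where "g' z d = d - \<alpha> *\<^sub>R loss_hessian M z d" for z d
    define H where "H w = w - \<alpha> *\<^sub>R ?\<nu> (loss_gradient M (?\<pi> w))" for w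
    define H' where "H' w d = d - \<alpha> *\<^sub>R \<Psi>' w d" for w d
    define P where "P = {p \<in> range ?\<pi>. loss_gradient M p = 0 \<and> \<not> is_global_min (fact_loss M) p}"
    have lift_inv: "?\<pi> (?\<nu> z) = z" if "z \<in> range ?\<pi>" for z
      using that mult_fst_generalized_inverse[OF N] by auto
    have grad_range: "loss_gradient M (?\<pi> w) \<in> range ?\<pi>" for w
      using loss_gradient_mult_fst by (rule range_eqI)
    have conj: "?\<pi> (H w) = g (?\<pi> w)" for w
      by (simp add: H_def g_def gradient_step_def linear_diff[OF linear_mult_fst]
          linear_scale[OF linear_mult_fst] lift_inv[OF grad_range])
    have conjk: "(g ^^ k) (?\<pi> w) = ?\<pi> ((H ^^ k) w)" for k w
      by (induction k) (simp_all add: conj)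
    have orbit: "(H ^^ k) w = ?\<nu> ((g ^^ k) (?\<pi> w)) + (w - ?\<nu> (?\<pi> w))" for k w
    proof (induction k)
      case (Suc k)
      have "(H ^^ Suc k) w = (H ^^ k) w - \<alpha> *\<^sub>R ?\<nu> (loss_gradient M ((g ^^ k) (?\<pi> w)))"
        by (simp add: H_def conjk)
      also have "\<dots> = ?\<nu> (g ((g ^^ k) (?\<pi> w))) + (w - ?\<nu> (?\<pi> w))"
        unfolding Suc by (simp add: g_def gradient_step_def linear_diff[OF linear_mult_fst]
            linear_scale[OF linear_mult_fst])
      finally show ?case by simp
    qed simp
    have negl: "negligible {w. (\<forall>k. (H ^^ k) w \<in> cball 0 R') \<and> (\<exists>p\<in>P. (\<lambda>k. ?\<pi> ((H ^^ k) w)) \<longlonglongrightarrow> p)}"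
    proof (rule strict_saddles_avoided[where g = g and g' = g' and H' = H'])
      show "linear ?\<pi>" by (rule linear_mult_fst)
      show "(g has_derivative g' z) (at z)" for z
        unfolding g_def g'_def[abs_def] by (rule gradient_step_has_derivative)
      show "continuous_on UNIV (\<lambda>z. g' z d)" for d
        unfolding g'_def by (intro continuous_intros continuous_on_loss_hessian)
      show "(H has_derivative H' w) (at w)" for w
      proof -
        have "((\<lambda>w. loss_gradient M (?\<pi> w)) has_derivative (\<lambda>d. loss_hessian M (?\<pi> w) (?\<pi> d))) (at w)"
          by (rule has_derivative_compose[OF linear_imp_has_derivative[OF linear_mult_fst] loss_gradient_has_derivative])
        then have "((\<lambda>w. ?\<nu> (loss_gradient M (?\<pi> w))) has_derivative \<Psi>' w) (at w)"
          unfolding \<Psi>'_def[abs_def]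
          by (rule bounded_linear.has_derivative[OF linear_linear[THEN iffD2, OF linear_mult_fst]])
        then show ?thesis unfolding H_def[abs_def] H'_def[abs_def]
          by (intro has_derivative_diff has_derivative_ident has_derivative_scaleR_right)
      qed
      show "inj (H' w)" if w: "w \<in> cball 0 R'" for w
      proof -
        have linH: "linear (H' w)"
          unfolding H'_def[abs_def] by (intro linear_compose_sub linear_ident linear_compose_scale_right lin\<Psi>)
        have "d = 0" if "H' w d = 0" for d
        proof -
          have "d = \<alpha> *\<^sub>R \<Psi>' w d" using that by (simp add: H'_def)
          then have "norm d = norm (\<alpha> *\<^sub>R \<Psi>' w d)" by (rule arg_cong)
          also have "\<dots> = \<alpha> * norm (\<Psi>' w d)" using \<alpha>(1) by simp
          also have "\<dots> \<le> (1 / (2 * L)) * (L * norm d)"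
            using \<alpha> L w by (intro mult_mono) auto
          also have "\<dots> = norm d / 2" using L(1) by simp
          finally show ?thesis by simp
        qed
        then show ?thesis using linH by (simp add: linear_injective_0)
      qed
      show "?\<pi> (H w) = g (?\<pi> w)" for w by (rule conj)
      show "(\<forall>x y. inner (g' p x) y = inner x (g' p y)) \<and> (\<exists>u. norm (?\<pi> u) < norm (g' p (?\<pi> u)))"
        if "p \<in> P" for p
      proof
        show "\<forall>x y. inner (g' p x) y = inner x (g' p y)"
          by (simp add: g'_def inner_diff_left inner_diff_right loss_hessian_selfadjoint)
        obtain w where "p = ?\<pi> w" using \<open>p \<in> P\<close> by (auto simp: P_def)
        then obtain u where "inner (loss_hessian M p (?\<pi> u)) (?\<pi> u) < 0"
          using saddle_has_negative_curvature[of M w] \<open>p \<in> P\<close> by (auto simp: P_def)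
        then show "\<exists>u. norm (?\<pi> u) < norm (g' p (?\<pi> u))"
          unfolding g'_def using negative_curvature_expands \<alpha>(1) by blast
      qed
    qed
    let ?good = "\<lambda>w. w \<in> \<A> \<times> \<B> \<longrightarrow> (\<exists>Z. is_global_min (fact_loss M) Z \<and>
           converges_linearly_to (gradient_descent (fact_loss M) \<alpha> (?\<pi> w)) Z)"
    have "{w. \<not> ?good w}
        \<subseteq> {w. (\<forall>k. (H ^^ k) w \<in> cball 0 R') \<and> (\<exists>p\<in>P. (\<lambda>k. ?\<pi> ((H ^^ k) w)) \<longlonglongrightarrow> p)}"
    proof
      fix w assume "w \<in> {w. \<not> ?good w}"
      then have w: "w \<in> \<A> \<times> \<B>" and bad: "\<And>Z. is_global_min (fact_loss M) Z \<Longrightarrow>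
          \<not> converges_linearly_to (gradient_descent (fact_loss M) \<alpha> (?\<pi> w)) Z" by auto
      have z0: "norm (?\<pi> w) \<le> K\<pi> * S"
        by (rule order_trans[OF K\<pi>(2) mult_left_mono[OF S[OF w]]]) (use K\<pi> in simp)
      have GDk: "norm ((gradient_step M \<alpha> ^^ k) (?\<pi> w)) \<le> R"
        "\<alpha> / 2 * (norm (loss_gradient M ((gradient_step M \<alpha> ^^ k) (?\<pi> w))))\<^sup>2
         \<le> fact_loss M ((gradient_step M \<alpha> ^^ k) (?\<pi> w)) - fact_loss M ((gradient_step M \<alpha> ^^ Suc k) (?\<pi> w))" for k
        using GD[OF \<alpha>(1) _ z0, of k] \<alpha>(2) by auto
      have "(gradient_step M \<alpha> ^^ k) (?\<pi> w) \<in> range ?\<pi>" for k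
        using conjk[of k w] by (simp add: g_def)
      then obtain p where p: "converges_linearly_to (\<lambda>k. (gradient_step M \<alpha> ^^ k) (?\<pi> w)) p"
        "(\<lambda>k. (gradient_step M \<alpha> ^^ k) (?\<pi> w)) \<longlonglongrightarrow> p" "loss_gradient M p = 0" "p \<in> range ?\<pi>"
        using gradient_descent_converges_to_critical[OF \<alpha>(1) GDk] by blast
      have "converges_linearly_to (gradient_descent (fact_loss M) \<alpha> (?\<pi> w)) p"
        using p(1) by (simp add: gradient_descent_eq_funpow[abs_def])
      then have "p \<in> P" using bad p(3,4) unfolding P_def by blast
      moreover have "(\<lambda>k. ?\<pi> ((H ^^ k) w)) \<longlonglongrightarrow> p" using p(2) by (simp add: g_def flip: conjk)
      moreover have "norm ((H ^^ k) w) \<le> R'" for k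
      proof -
        have "norm (?\<nu> ((g ^^ k) (?\<pi> w))) \<le> K\<nu> * R"
          by (rule order_trans[OF K\<nu>(2) mult_left_mono]) (use GDk(1) K\<nu> in \<open>auto simp: g_def\<close>)
        moreover have "norm (?\<nu> (?\<pi> w)) \<le> K\<nu> * (K\<pi> * S)"
          by (rule order_trans[OF K\<nu>(2) mult_left_mono[OF z0]]) (use K\<nu> in simp)
        moreover have "norm (w - ?\<nu> (?\<pi> w)) \<le> norm w + norm (?\<nu> (?\<pi> w))" by (rule norm_triangle_ineq4)
        moreover have "norm ((H ^^ k) w) \<le> norm (?\<nu> ((g ^^ k) (?\<pi> w))) + norm (w - ?\<nu> (?\<pi> w))"
          unfolding orbit by (rule norm_triangle_ineq)
        ultimately show ?thesis using S[OF w] unfolding R'_def by linarith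
      qed
      ultimately show "w \<in> {w. (\<forall>k. (H ^^ k) w \<in> cball 0 R') \<and> (\<exists>p\<in>P. (\<lambda>k. ?\<pi> ((H ^^ k) w)) \<longlonglongrightarrow> p)}"
        by auto
    qed
    then have "negligible {w. \<not> ?good w}" using negl negligible_subset by blast
    then have "AE w in lebesgue. ?good w"
      by (intro AE_I'[of "{w. \<not> ?good w}"]) (auto simp: negligible_iff_null_sets)
    then show ?thesis
    proof (rule eventually_mono)
      fix w assume "?good w"
      then show "case w of (A, B) \<Rightarrow> (A, B) \<in> \<A> \<times> \<B> \<longrightarrow>
        (\<exists>Z. is_global_min (fact_loss M) Z \<and>
           converges_linearly_to (gradient_descent (fact_loss M) \<alpha> (M ** A, B)) Z)"
        by (cases w) (simp only: mult_fst_def prod.case fst_conv snd_conv)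
    qed
  qed
  moreover have "min b (1 / (2 * L)) > 0" using b L(1) by simp
  ultimately show ?thesis by (intro exI[of _ "min b (1 / (2 * L))"]) auto
qed

end
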